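(* (i) Let $F : [0,\infty) \to [0,\infty)$. Then $F \circ \mathbf{a} = (F(a_n))_{n \in \mathbb{Z}}$ is a Pólya frequency sequence for every Pólya frequency sequence $\mathbf{a} = (a_n)_{n \in \mathbb{Z}}$ if and only if there is a constant $c \geq 0$ such that $F(x) = c$ for all $x \geq 0$ or $F(x) = cx$ for all $x \geq 0$. (ii) Let $F : (0,\infty) \to (0,\infty)$. Then $F \circ \mathbf{a}$ is a totally positive Pólya frequency sequence for every totally positive Pólya frequency sequence $\mathbf{a}$ if and only if there is a constant $c > 0$ such that $F(x) = cx$ for all $x > 0$.
   Context: A Pólya frequency sequence is a real sequence $\mathbf{a} = (a_n)_{n \in \mathbb{Z}}$ such that the Toeplitz kernel $T_{\mathbf{a}} : \mathbb{Z} \times \mathbb{Z} \to \mathbb{R}$, $(i,j) \mapsto a_{i-j}$, is totally non-negative, i.e. $\det(a_{i_k - j_l})_{k,l=1}^n \geq 0$ for all $n \in \mathbb{N}$ and all integers $i_1 < \cdots < i_n$, $j_1 < \cdots < j_n$. It is totally positive if all these determinants are strictly positive. *)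

theory Defs
  imports Complex_Main "Jordan_Normal_Form.Determinant"
begin

definition kernel_minor ::
    "(int \<Rightarrow> int \<Rightarrow> real) \<Rightarrow> nat \<Rightarrow> (nat \<Rightarrow> int) \<Rightarrow> (nat \<Rightarrow> int) \<Rightarrow> real" where
  "kernel_minor K n i j = det (mat n n (\<lambda>(k, l). K (i k) (j l)))"

text \<open>Matrices are indexed from 0, so an increasing tuple of \<open>n\<close> integers is a function that is
  strictly increasing on \<open>{..<n}\<close>; its values outside that set are irrelevant.\<close>

definition totally_nonnegative :: "(int \<Rightarrow> int \<Rightarrow> real) \<Rightarrow> bool" where
  "totally_nonnegative K \<longleftrightarrow>
     (\<forall>n\<ge>1. \<forall>i j. strict_mono_on {..<n} i \<longrightarrow> strict_mono_on {..<n} j \<longrightarrow> kernel_minor K n i j \<ge> 0)"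

definition totally_positive :: "(int \<Rightarrow> int \<Rightarrow> real) \<Rightarrow> bool" where
  "totally_positive K \<longleftrightarrow>
     (\<forall>n\<ge>1. \<forall>i j. strict_mono_on {..<n} i \<longrightarrow> strict_mono_on {..<n} j \<longrightarrow> kernel_minor K n i j > 0)"

definition toeplitz_kernel :: "(int \<Rightarrow> real) \<Rightarrow> int \<Rightarrow> int \<Rightarrow> real" where
  "toeplitz_kernel a i j = a (i - j)"

definition polya_frequency_sequence :: "(int \<Rightarrow> real) \<Rightarrow> bool" where
  "polya_frequency_sequence a \<longleftrightarrow> totally_nonnegative (toeplitz_kernel a)"

definition tp_polya_frequency_sequence :: "(int \<Rightarrow> real) \<Rightarrow> bool" where
  "tp_polya_frequency_sequence a \<longleftrightarrow>
     polya_frequency_sequence a \<and> totally_positive (toeplitz_kernel a)"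

end

theory Submission
  imports Defs "HOL-Real_Asymp.Real_Asymp"
begin

text \<open>
  Let \<open>F\<close> preserve Polya frequency sequences, with \<open>F 0 = 0\<close> and \<open>F \<noteq> 0\<close> (if \<open>F 0 > 0\<close>, the unit
  sequence already forces \<open>F\<close> to be constant). If \<open>b\<close> has nonnegative Toeplitz minors and
  \<open>b (n + 1) / b n \<rightarrow> 1\<close>, then a column far to the left is asymptotically constant and may be eliminated,
  so the differences of \<open>b\<close> again have nonnegative minors (removal of a pole at 1 of the generating
  function). For \<open>b n = F (\<eta> n)\<close> this works twice. If it worked three times, the sequences with
  generating function \<open>1 / ((1 - z)\<^sup>2 (1 - \<beta> / z))\<close> would yield a third-order difference inequality that
  makes \<open>F\<close> grow faster than any power, whereas geometric sequences bound \<open>F (2 x) / F x\<close>. Hence the second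
  differences of \<open>F (\<eta> n)\<close> decay exponentially and \<open>F (\<eta> n) = A n + B + o(1)\<close> with \<open>B \<le> 0\<close>; the triangular
  numbers, for which three differences are available, give \<open>B \<ge> 0\<close>, and \<open>F (\<eta> n) = n F \<eta>\<close> follows.
  Geometric sequences then rule out every other function.

  All sequences used are limits of totally positive ones. A function that preserves total positivity is
  increasing and continuous by testing the Gaussian sequences \<open>x r\<^sup>n q\<^bsup>n\<^sup>2\<^esup>\<close>, so it extends continuously
  to 0 and the argument above applies to the extension.
\<close>

section \<open>Determinants of real functions\<close>

definition fun_det :: "nat \<Rightarrow> (nat \<Rightarrow> nat \<Rightarrow> real) \<Rightarrow> real" where
  "fun_det n f = det (mat n n (\<lambda>(k, l). f k l))"

lemma fun_det_leibniz:
  "fun_det n f = (\<Sum>p | p permutes {0..<n}. signof p * (\<Prod>k = 0..<n. f k (p k)))"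
  unfolding fun_det_def
  by (subst det_def'[where n = n], simp, rule sum.cong, simp, intro arg_cong2[where f = times] prod.cong)
     (auto dest: permutes_in_image)

lemma fun_det_cong: "(\<And>k l. k < n \<Longrightarrow> l < n \<Longrightarrow> f k l = g k l) \<Longrightarrow> fun_det n f = fun_det n g"
  unfolding fun_det_def by (intro arg_cong[where f = det] eq_matI) auto

lemma fun_det_0 [simp]: "fun_det 0 f = 1"
  unfolding fun_det_def by simp

lemma fun_det_1: "fun_det (Suc 0) f = f 0 0"
  unfolding fun_det_def by (subst det_single) auto

lemma fun_det_transpose: "fun_det n (\<lambda>k l. f l k) = fun_det n f"
proof -
  have "mat n n (\<lambda>(k, l). f l k) = transpose_mat (mat n n (\<lambda>(k, l). f k l))"
    by (intro eq_matI) auto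
  then show ?thesis unfolding fun_det_def by (simp add: det_transpose[where n = n])
qed

lemma fun_det_eq_rows:
  assumes "a < n" "b < n" "a \<noteq> b" "\<And>l. l < n \<Longrightarrow> f a l = f b l"
  shows "fun_det n f = 0"
  unfolding fun_det_def
  by (rule det_identical_rows[where n = n and i = a and j = b]) (use assms in \<open>auto intro!: eq_vecI\<close>)

lemma fun_det_scale_rows: "fun_det n (\<lambda>k l. r k * f k l) = (\<Prod>k = 0..<n. r k) * fun_det n f"
  unfolding fun_det_leibniz sum_distrib_left by (intro sum.cong) (auto simp: prod.distrib)

lemma fun_det_scale_cols: "fun_det n (\<lambda>k l. c l * f k l) = (\<Prod>k = 0..<n. c k) * fun_det n f"
proof -
  have "fun_det n (\<lambda>k l. c l * f k l) = fun_det n (\<lambda>k l. c k * f l k)"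
    by (rule fun_det_transpose)
  also have "\<dots> = (\<Prod>k = 0..<n. c k) * fun_det n (\<lambda>k l. f l k)"
    by (rule fun_det_scale_rows)
  finally show ?thesis by (simp only: fun_det_transpose[of n f])
qed

lemma fun_det_tendsto:
  assumes "\<And>k l. k < n \<Longrightarrow> l < n \<Longrightarrow> ((\<lambda>x. f x k l) \<longlongrightarrow> g k l) F"
  shows "((\<lambda>x. fun_det n (f x)) \<longlongrightarrow> fun_det n g) F"
  unfolding fun_det_leibniz
  by (intro tendsto_sum tendsto_mult tendsto_const tendsto_prod assms) (auto dest: permutes_in_image)

text \<open>Multilinearity in the rows, as in the Cauchy-Binet formula: distributing the product of
  sums in the Leibniz formula leaves one determinant for each choice of a summand in every
  row.\<close>

lemma fun_det_expand_rows:
  assumes fin: "\<And>k. k < n \<Longrightarrow> finite (S k)"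
    and eq: "\<And>k l. k < n \<Longrightarrow> l < n \<Longrightarrow> f k l = (\<Sum>m\<in>S k. w k m * A m l)"
  shows "fun_det n f = (\<Sum>g\<in>Pi\<^sub>E {0..<n} S. (\<Prod>k = 0..<n. w k (g k)) * fun_det n (\<lambda>k. A (g k)))"
proof -
  have "fun_det n f = fun_det n (\<lambda>k l. \<Sum>m\<in>S k. w k m * A m l)"
    by (rule fun_det_cong) (rule eq)
  also have "\<dots> = (\<Sum>p | p permutes {0..<n}. signof p *
      (\<Sum>g\<in>Pi\<^sub>E {0..<n} S. \<Prod>k = 0..<n. w k (g k) * A (g k) (p k)))"
    unfolding fun_det_leibniz using fin by (subst prod_sum_PiE) auto
  also have "\<dots> = (\<Sum>g\<in>Pi\<^sub>E {0..<n} S. (\<Prod>k = 0..<n. w k (g k)) * fun_det n (\<lambda>k. A (g k)))"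
    unfolding fun_det_leibniz sum_distrib_left
    by (subst sum.swap) (simp add: prod.distrib mult_ac)
  finally show ?thesis .
qed

text \<open>Each subtraction uses the original preceding row, so all of them together are left
  multiplication by a lower bidiagonal matrix with unit diagonal.\<close>

lemma fun_det_row_diff:
  assumes "\<And>l. l < n \<Longrightarrow> f' 0 l = f 0 l"
    and "\<And>k l. Suc k < n \<Longrightarrow> l < n \<Longrightarrow> f' (Suc k) l = f (Suc k) l - c k * f k l"
  shows "fun_det n f' = fun_det n f"
proof -
  define L where "L = mat n n (\<lambda>(k, l). if l = k then 1 else if Suc l = k then - c l else (0::real))"
  define A where "A = mat n n (\<lambda>(k, l). f k l)"
  have L: "L \<in> carrier_mat n n" and A: "A \<in> carrier_mat n n"
    by (auto simp: L_def A_def)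
  have eq: "mat n n (\<lambda>(k, l). f' k l) = L * A"
  proof (rule eq_matI)
    fix k l assume kl: "k < dim_row (L * A)" "l < dim_col (L * A)"
    then have kl: "k < n" "l < n" using L A by auto
    have "(L * A) $$ (k, l) = (\<Sum>m = 0..<n. L $$ (k, m) * A $$ (m, l))"
      using kl L A by (simp add: scalar_prod_def)
    also have "\<dots> = (\<Sum>m = 0..<n. (if m = k then f m l else 0) + (if Suc m = k then - c m * f m l else 0))"
      using kl by (intro sum.cong) (auto simp: L_def A_def)
    also have "\<dots> = f' k l"
    proof (cases k)
      case 0
      then show ?thesis using kl assms(1) by (simp add: sum.distrib)
    next
      case (Suc j)
      have "(\<Sum>m = 0..<n. if Suc m = k then - c m * f m l else 0) = (\<Sum>m = 0..<n. if m = j then - c m * f m l else 0)"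
        using Suc by (intro sum.cong) auto
      then show ?thesis using kl Suc assms(2)[of j l] by (simp add: sum.distrib)
    qed
    finally show "mat n n (\<lambda>(k, l). f' k l) $$ (k, l) = (L * A) $$ (k, l)"
      using kl by simp
  qed (use L A in auto)
  have "det L = prod_list (diag_mat L)"
    by (rule det_lower_triangular[OF _ L]) (auto simp: L_def)
  also have "diag_mat L = map (\<lambda>i. 1) [0..<n]"
    unfolding diag_mat_def using L by (intro map_cong) (auto simp: L_def)
  also have "prod_list \<dots> = (1::real)"
    by (induction n) auto
  finally show ?thesis
    unfolding fun_det_def eq using det_mult[OF L A] by (simp add: A_def)
qed

lemma fun_det_first_col:
  assumes "f 0 0 = 1" "\<And>k. k < n \<Longrightarrow> f (Suc k) 0 = 0"
  shows "fun_det (Suc n) f = fun_det n (\<lambda>k l. f (Suc k) (Suc l))"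
proof -
  let ?A = "mat (Suc n) (Suc n) (\<lambda>(k, l). f k l)"
  have A: "?A \<in> carrier_mat (Suc n) (Suc n)" by simp
  have "det ?A = (\<Sum>k<Suc n. ?A $$ (k, 0) * cofactor ?A k 0)"
    by (rule laplace_expansion_column[OF A]) simp
  also have "\<dots> = cofactor ?A 0 0"
    using assms by (simp add: sum.lessThan_Suc_shift del: sum.lessThan_Suc)
  also have "\<dots> = det (mat n n (\<lambda>(k, l). f (Suc k) (Suc l)))"
    unfolding cofactor_def mat_delete_def
    by (simp, intro arg_cong[where f = det] eq_matI) auto
  finally show ?thesis unfolding fun_det_def .
qed

lemma fun_det_2: "fun_det 2 f = f 0 0 * f 1 1 - f 0 1 * f 1 0"
proof -
  let ?A = "mat 2 2 (\<lambda>(k, l). f k l)"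
  have "det ?A = (\<Sum>k<2. ?A $$ (k, 0) * cofactor ?A k 0)"
    by (rule laplace_expansion_column[where n = 2]) auto
  then show ?thesis
    unfolding fun_det_def numeral_2_eq_2
    by (simp add: cofactor_def mat_delete_def det_single[of "mat (Suc 0) (Suc 0) _"])
qed

lemma fun_det_3: "fun_det 3 f = f 0 0 * (f 1 1 * f 2 2 - f 1 2 * f 2 1) - f 1 0 * (f 0 1 * f 2 2 - f 0 2 * f 2 1)
   + f 2 0 * (f 0 1 * f 1 2 - f 0 2 * f 1 1)"
proof -
  let ?A = "mat 3 3 (\<lambda>(k, l). f k l)"
  have "det ?A = (\<Sum>k<3. ?A $$ (k, 0) * cofactor ?A k 0)"
    by (rule laplace_expansion_column[where n = 3]) auto
  moreover have "cofactor ?A 0 0 = fun_det 2 (\<lambda>k l. f (Suc k) (Suc l))"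
    unfolding cofactor_def mat_delete_def fun_det_def by (simp, intro arg_cong[where f = det] eq_matI) auto
  moreover have "cofactor ?A 1 0 = - fun_det 2 (\<lambda>k l. f (if k = 0 then 0 else 2) (Suc l))"
    unfolding cofactor_def mat_delete_def fun_det_def by (simp, intro arg_cong[where f = det] eq_matI) (auto simp: less_Suc_eq numeral_2_eq_2)
  moreover have "cofactor ?A 2 0 = fun_det 2 (\<lambda>k l. f k (Suc l))"
    unfolding cofactor_def mat_delete_def fun_det_def by (simp, intro arg_cong[where f = det] eq_matI) auto
  moreover have "(\<Sum>k<3. g k) = g 0 + g 1 + g 2" for g :: "nat \<Rightarrow> real"
    by (simp add: eval_nat_numeral)
  ultimately have "fun_det 3 f = f 0 0 * fun_det 2 (\<lambda>k l. f (Suc k) (Suc l))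
     - f 1 0 * fun_det 2 (\<lambda>k l. f (if k = 0 then 0 else 2) (Suc l)) + f 2 0 * fun_det 2 (\<lambda>k l. f k (Suc l))"
    by (simp add: fun_det_def[of 3])
  then show ?thesis
    unfolding fun_det_2 by (simp add: numeral_2_eq_2)
qed

section \<open>Operations on Polya frequency sequences\<close>

abbreviation incr :: "nat \<Rightarrow> (nat \<Rightarrow> int) \<Rightarrow> bool" where
  "incr n i \<equiv> strict_mono_on {..<n} i"

definition toeplitz_minor :: "(int \<Rightarrow> real) \<Rightarrow> nat \<Rightarrow> (nat \<Rightarrow> int) \<Rightarrow> (nat \<Rightarrow> int) \<Rightarrow> real" where
  "toeplitz_minor a n i j = fun_det n (\<lambda>k l. a (i k - j l))"

lemma kernel_minor_toeplitz: "kernel_minor (toeplitz_kernel a) n i j = toeplitz_minor a n i j"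
  by (simp add: kernel_minor_def toeplitz_kernel_def toeplitz_minor_def fun_det_def)

lemma toeplitz_minor_0 [simp]: "toeplitz_minor a 0 i j = 1"
  by (simp add: toeplitz_minor_def)

lemma pfs_iff: "polya_frequency_sequence a \<longleftrightarrow> (\<forall>n i j. incr n i \<longrightarrow> incr n j \<longrightarrow> 0 \<le> toeplitz_minor a n i j)"
  unfolding polya_frequency_sequence_def totally_nonnegative_def kernel_minor_toeplitz
  by (metis toeplitz_minor_0 less_one linorder_not_less zero_le_one)

lemma tp_pfs_iff: "tp_polya_frequency_sequence a \<longleftrightarrow> (\<forall>n i j. incr n i \<longrightarrow> incr n j \<longrightarrow> 0 < toeplitz_minor a n i j)"
proof -
  have "totally_positive (toeplitz_kernel a) \<longleftrightarrow> (\<forall>n i j. incr n i \<longrightarrow> incr n j \<longrightarrow> 0 < toeplitz_minor a n i j)"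
    unfolding totally_positive_def kernel_minor_toeplitz
  proof safe
    fix n i j assume "\<forall>n\<ge>1. \<forall>i j. incr n i \<longrightarrow> incr n j \<longrightarrow> 0 < toeplitz_minor a n i j" "incr n i" "incr n j"
    then show "0 < toeplitz_minor a n i j" by (cases "n = 0") auto
  qed auto
  then show ?thesis
    unfolding tp_polya_frequency_sequence_def pfs_iff by (auto intro: less_imp_le)
qed

lemma toeplitz_minor_cong: "(\<And>k. k < n \<Longrightarrow> i k = i' k) \<Longrightarrow> (\<And>k. k < n \<Longrightarrow> j k = j' k) \<Longrightarrow> toeplitz_minor a n i j = toeplitz_minor a n i' j'"
  unfolding toeplitz_minor_def by (rule fun_det_cong) auto

lemma incrD: "incr n i \<Longrightarrow> k < l \<Longrightarrow> l < n \<Longrightarrow> i k < i l"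
  by (auto simp: strict_mono_on_def)

lemma incrI: "(\<And>k l. k < l \<Longrightarrow> l < n \<Longrightarrow> i k < i l) \<Longrightarrow> incr n i"
  by (auto simp: strict_mono_on_def)

text \<open>A weakly increasing tuple that is not strictly increasing repeats a row, and then the
  minor vanishes.\<close>

lemma toeplitz_minor_mono_tuple_nonneg:
  assumes "polya_frequency_sequence a" "incr n j" "\<And>k l. k < l \<Longrightarrow> l < n \<Longrightarrow> g k \<le> g l"
  shows "0 \<le> toeplitz_minor a n g j"
proof (cases "incr n g")
  case True
  then show ?thesis using assms by (auto simp: pfs_iff)
next
  case False
  then obtain k l where "k < l" "l < n" "\<not> g k < g l" by (auto simp: strict_mono_on_def)
  with assms(3)[of k l] have "toeplitz_minor a n g j = 0"
    unfolding toeplitz_minor_def by (intro fun_det_eq_rows[of k _ l]) auto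
  then show ?thesis by simp
qed

text \<open>Since the windows \<open>S k\<close> are ordered, only weakly increasing row tuples occur in the multilinear
  expansion, and none of them contributes a negative term.\<close>

lemma fun_det_window_ge:
  assumes pf: "polya_frequency_sequence a" and j: "incr n j"
    and fin: "\<And>k. k < n \<Longrightarrow> finite (S k)"
    and ord: "\<And>k l m m'. k < l \<Longrightarrow> l < n \<Longrightarrow> m \<in> S k \<Longrightarrow> m' \<in> S l \<Longrightarrow> m \<le> m'"
    and w: "\<And>k m. k < n \<Longrightarrow> m \<in> S k \<Longrightarrow> 0 \<le> w k m"
    and f: "\<And>k l. k < n \<Longrightarrow> l < n \<Longrightarrow> f k l = (\<Sum>m\<in>S k. w k m * a (m - j l))"
    and g: "\<And>k. k < n \<Longrightarrow> g k \<in> S k"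
  shows "(\<Prod>k = 0..<n. w k (g k)) * toeplitz_minor a n g j \<le> fun_det n f"
proof -
  have exp: "fun_det n f = (\<Sum>g\<in>Pi\<^sub>E {0..<n} S. (\<Prod>k = 0..<n. w k (g k)) * toeplitz_minor a n g j)"
    unfolding toeplitz_minor_def by (rule fun_det_expand_rows[OF fin f])
  have nn: "0 \<le> (\<Prod>k = 0..<n. w k (g k)) * toeplitz_minor a n g j" if "g \<in> Pi\<^sub>E {0..<n} S" for g
    using that by (intro mult_nonneg_nonneg prod_nonneg toeplitz_minor_mono_tuple_nonneg[OF pf j])
      (auto intro!: w intro: ord simp: PiE_iff)
  let ?g = "restrict g {0..<n}"
  have mem: "?g \<in> Pi\<^sub>E {0..<n} S" using g by auto
  have "(\<Prod>k = 0..<n. w k (?g k)) * toeplitz_minor a n ?g j \<le> fun_det n f"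
    unfolding exp using fin by (intro member_le_sum[OF mem nn] finite_PiE) auto
  moreover have "toeplitz_minor a n ?g j = toeplitz_minor a n g j" by (rule toeplitz_minor_cong) auto
  ultimately show "(\<Prod>k = 0..<n. w k (g k)) * toeplitz_minor a n g j \<le> fun_det n f" by simp
qed

section \<open>Multiplication of the generating function by \<open>1 + \<alpha> z\<close>\<close>

context
  fixes a b :: "int \<Rightarrow> real" and \<alpha> :: real
  assumes pf: "polya_frequency_sequence a" and \<alpha>: "0 \<le> \<alpha>"
    and b: "\<And>n. b n = a n + \<alpha> * a (n - 1)"
begin

text \<open>Row \<open>i k\<close> of the new kernel combines the rows \<open>i k - 1\<close> and
  \<open>i k\<close> of the old one. These windows are ordered and share at most an endpoint, so a
  single summand of the expansion is a lower bound.\<close>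

lemma toeplitz_minor_linear_factor_ge:
  assumes i: "incr n i" and j: "incr n j" and g: "\<And>k. k < n \<Longrightarrow> g k \<in> {i k - 1, i k}"
  shows "(\<Prod>k = 0..<n. if g k = i k then 1 else \<alpha>) * toeplitz_minor a n g j \<le> toeplitz_minor b n i j"
  unfolding toeplitz_minor_def[of b]
proof (rule fun_det_window_ge[OF pf j, where S = "\<lambda>k. {i k - 1, i k}" and w = "\<lambda>k m. if m = i k then 1 else \<alpha>"])
  show "m \<le> m'" if "k < l" "l < n" "m \<in> {i k - 1, i k}" "m' \<in> {i l - 1, i l}" for k l m m'
    using incrD[OF i that(1,2)] that(3,4) by auto
  show "b (i k - j l) = (\<Sum>m\<in>{i k - 1, i k}. (if m = i k then 1 else \<alpha>) * a (m - j l))" for k l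
    by (simp add: b algebra_simps)
qed (use \<alpha> g in auto)

lemma toeplitz_minor_linear_factor_mono: "incr n i \<Longrightarrow> incr n j \<Longrightarrow> toeplitz_minor a n i j \<le> toeplitz_minor b n i j"
  using toeplitz_minor_linear_factor_ge[of n i j i] by simp

lemma pfs_linear_factor: "polya_frequency_sequence b"
  using toeplitz_minor_linear_factor_mono pf unfolding pfs_iff by (meson order_trans)

end

section \<open>Division of the generating function by \<open>1 - \<alpha> z\<close>\<close>

context
  fixes a c :: "int \<Rightarrow> real" and \<alpha> :: real
  assumes pf: "polya_frequency_sequence a" and \<alpha>: "0 \<le> \<alpha>"
    and c: "\<And>n. c n = \<alpha> * c (n - 1) + a n"
    and lim: "\<And>n. (\<lambda>M. \<alpha> ^ M * c (n - int M)) \<longlonglongrightarrow> 0"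
begin

text \<open>The remainder after \<open>M\<close> steps tends to 0 by the assumption
  \<open>lim\<close>, which singles out \<open>c\<close> among the solutions of the
  recursion.\<close>

lemma geometric_factor_iterate:
  "c n = \<alpha> ^ M * c (n - int M) + (\<Sum>m\<in>{n - int M<..n}. \<alpha> ^ nat (n - m) * a m)"
proof (induction M)
  case (Suc M)
  have "{n - int (Suc M)<..n} = insert (n - int M) {n - int M<..n}" by auto
  then show ?case using Suc c[of "n - int M"] by (simp add: algebra_simps)
qed simp

text \<open>Subtracting from each row the right multiple of the preceding one turns row
  \<open>k\<close> into a weighted sum of the rows of \<open>a\<close> from \<open>i (k - 1)\<close>
  (excluded) to \<open>i k\<close>. These windows are disjoint and ordered, and the choice
  \<open>i\<close> has weight 1.\<close>

lemma toeplitz_minor_geometric_factor_mono: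
  assumes i: "incr n i" and j: "incr n j"
  shows "toeplitz_minor a n i j \<le> toeplitz_minor c n i j"
proof -
  \<comment> \<open>The first row has no predecessor, so its infinite window is truncated at length
    \<open>M\<close>, which tends to infinity later.\<close>
  define S where "S = (\<lambda>M k. if k = 0 then {i 0 - int M<..i 0} else {i (k - 1)<..i k})"
  define F where "F = (\<lambda>M k l. \<Sum>m\<in>S M k. \<alpha> ^ nat (i k - m) * a (m - j l))"
  \<comment> \<open>\<open>E\<close> is the row-reduced matrix of \<open>c\<close>: the limit of the
    truncations \<open>F M\<close>, with the same determinant as the matrix of
    \<open>c\<close>.\<close>
  define E where "E = (\<lambda>k l. if k = 0 then c (i 0 - j l) else c (i k - j l) - \<alpha> ^ nat (i k - i (k - 1)) * c (i (k - 1) - j l))"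
  have shift: "(\<Sum>m\<in>{u - v - int M<..u - v}. \<alpha> ^ nat (u - v - m) * a m)
      = (\<Sum>m\<in>{u - int M<..u}. \<alpha> ^ nat (u - m) * a (m - v))" for u v M
    by (rule sum.reindex_bij_witness[of _ "\<lambda>m. m - v" "\<lambda>m. m + v"]) (auto simp: algebra_simps)
  have it: "c (u - v) = \<alpha> ^ M * c (u - v - int M) + (\<Sum>m\<in>{u - int M<..u}. \<alpha> ^ nat (u - m) * a (m - v))" for u v M
    unfolding shift[symmetric] by (rule geometric_factor_iterate)
  have lower: "toeplitz_minor a n i j \<le> fun_det n (F M)" if "0 < M" for M
  proof -
    have "(\<Prod>k = 0..<n. \<alpha> ^ nat (i k - i k)) * toeplitz_minor a n i j \<le> fun_det n (F M)"
    proof (rule fun_det_window_ge[OF pf j, where S = "S M" and w = "\<lambda>k m. \<alpha> ^ nat (i k - m)" and f = "F M"])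
      show "m \<le> m'" if "k < l" "l < n" "m \<in> S M k" "m' \<in> S M l" for k l m m'
      proof -
        have "m \<le> i k" "i (l - 1) < m'" using that by (auto simp: S_def split: if_splits)
        moreover have "i k \<le> i (l - 1)"
        proof -
          have "k = l - 1 \<or> k < l - 1 \<and> l - 1 < n" using that(1,2) by linarith
          then show ?thesis using incrD[OF i, of k "l - 1"] by fastforce
        qed
        ultimately show ?thesis by simp
      qed
      show "i k \<in> S M k" if "k < n" for k
        using that \<open>0 < M\<close> incrD[OF i, of "k - 1" k] by (auto simp: S_def)
    qed (use \<alpha> in \<open>auto simp: S_def F_def\<close>)
    then show ?thesis by simp
  qed
  have "(\<lambda>M. F M k l) \<longlonglongrightarrow> E k l" if "k < n" for k l
  proof (cases "k = 0")
    case True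
    have "F M k l = c (i 0 - j l) - \<alpha> ^ M * c (i 0 - j l - int M)" for M
      using it[of "i 0" "j l" M] True by (simp add: F_def S_def)
    then show ?thesis using tendsto_diff[OF tendsto_const lim] True by (simp add: E_def)
  next
    case False
    have less: "i (k - 1) < i k" using that False incrD[OF i, of "k - 1" k] by auto
    define M where "M = nat (i k - i (k - 1))"
    have M: "int M = i k - i (k - 1)" using less by (simp add: M_def)
    have "F M' k l = E k l" for M'
      using it[of "i k" "j l" M] False less by (simp add: F_def S_def E_def M) (simp add: M_def)
    then show ?thesis by simp
  qed
  then have "(\<lambda>M. fun_det n (F M)) \<longlonglongrightarrow> fun_det n E" by (rule fun_det_tendsto)
  then have "toeplitz_minor a n i j \<le> fun_det n E"
    by (rule LIMSEQ_le_const) (use lower in \<open>auto intro!: exI[of _ 1]\<close>)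
  also have "fun_det n E = toeplitz_minor c n i j"
    unfolding toeplitz_minor_def by (rule fun_det_row_diff[where c = "\<lambda>k. \<alpha> ^ nat (i (Suc k) - i k)"]) (auto simp: E_def)
  finally show ?thesis .
qed

end

section \<open>Reflection, scaling, shifts and limits\<close>

lemma toeplitz_minor_reflect: "toeplitz_minor (\<lambda>n. a (- n)) n i j = toeplitz_minor a n j i"
  unfolding toeplitz_minor_def using fun_det_transpose[of n "\<lambda>k l. a (j k - i l)"] by simp

lemma pfs_reflect: "polya_frequency_sequence a \<Longrightarrow> polya_frequency_sequence (\<lambda>n. a (- n))"
  by (simp add: pfs_iff toeplitz_minor_reflect)

lemma toeplitz_minor_scale: "toeplitz_minor (\<lambda>m. c * a m) n i j = c ^ n * toeplitz_minor a n i j"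
  unfolding toeplitz_minor_def using fun_det_scale_rows[of n "\<lambda>_. c"] by simp

lemma toeplitz_minor_shift: "toeplitz_minor (\<lambda>m. a (m + s)) n i j = toeplitz_minor a n (\<lambda>k. i k + s) j"
  unfolding toeplitz_minor_def by (simp add: algebra_simps)

lemma toeplitz_minor_tendsto: "(\<And>n. ((\<lambda>x. A x n) \<longlongrightarrow> a n) F) \<Longrightarrow> ((\<lambda>x. toeplitz_minor (A x) n i j) \<longlongrightarrow> toeplitz_minor a n i j) F"
  unfolding toeplitz_minor_def by (rule fun_det_tendsto)

lemma pfs_limit:
  assumes "\<And>m::nat. polya_frequency_sequence (A m)" "\<And>n. (\<lambda>m. A m n) \<longlonglongrightarrow> a n"
  shows "polya_frequency_sequence a"
  unfolding pfs_iff
proof (intro allI impI)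
  fix n i j assume "incr n i" "incr n j"
  with assms(1) have "0 \<le> toeplitz_minor (A m) n i j" for m by (simp add: pfs_iff)
  then show "0 \<le> toeplitz_minor a n i j"
    by (intro LIMSEQ_le_const[OF toeplitz_minor_tendsto[OF assms(2)]]) auto
qed

lemma strict_mono_permutes_id:
  assumes p: "p permutes {0..<n::nat}" and mono: "\<And>k l. k < l \<Longrightarrow> l < n \<Longrightarrow> p k < p l"
  shows "p = id"
proof (rule permutes_natset_ge[OF p], rule ballI)
  fix k assume "k \<in> {0..<n}"
  then show "k \<le> p k"
  proof (induction k)
    case (Suc k)
    then show ?case using mono[of k "Suc k"] by auto
  qed simp
qed

text \<open>A permutation contributes to the Leibniz formula only if \<open>i k = j (p k)\<close>
  for all \<open>k\<close>. As both tuples increase, so does \<open>p\<close>, which is then the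
  identity and has sign 1.\<close>

lemma pfs_delta: "polya_frequency_sequence (\<lambda>n. if n = 0 then 1 else 0)"
  unfolding pfs_iff
proof (intro allI impI)
  fix n i j assume i: "incr n i" and j: "incr n j"
  show "0 \<le> toeplitz_minor (\<lambda>n. if n = 0 then 1 else 0) n i j"
    unfolding toeplitz_minor_def fun_det_leibniz
  proof (rule sum_nonneg)
    fix p assume p: "p \<in> {p. p permutes {0..<n}}"
    show "0 \<le> signof p * (\<Prod>k = 0..<n. if i k - j (p k) = 0 then 1 else 0 :: real)"
    proof (cases "\<forall>k<n. i k = j (p k)")
      case True
      have "p k < p l" if kl: "k < l" "l < n" for k l
      proof (rule ccontr)
        have "p k < n" "p l < n" using p kl permutes_in_image[of p "{0..<n}"] by auto
        assume "\<not> p k < p l"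
        then have "j (p l) \<le> j (p k)"
          using j \<open>p k < n\<close> by (cases "p k = p l") (auto simp: strict_mono_on_def intro!: less_imp_le)
        then show False using True incrD[OF i kl] kl by auto
      qed
      then have "p = id" using p by (intro strict_mono_permutes_id) auto
      then show ?thesis by (simp add: prod_nonneg)
    next
      case False
      then have "(\<Prod>k = 0..<n. if i k - j (p k) = 0 then 1 else 0 :: real) = 0"
        by (intro prod_zero) auto
      then show ?thesis by (simp only: mult_zero_right order_refl)
    qed
  qed
qed

section \<open>Generalized Vandermonde determinants and Gaussian sequences\<close>

lemma sum_telescope_int:
  fixes h :: "int \<Rightarrow> real"
  assumes "u \<le> v"
  shows "(\<Sum>m\<in>{u..<v}. h (m + 1) - h m) = h v - h u"
  using assms
proof (induction v rule: int_ge_induct)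
  case (step v)
  have "{u..<v + 1} = insert v {u..<v}" using step by auto
  then show ?case using step by simp
qed simp

text \<open>A generalized Vandermonde determinant. Normalising the first column to 1 and taking
  differences of consecutive rows lowers the size by one; each difference telescopes, so the smaller
  determinant expands into a sum of determinants of the same kind, over row tuples that interlace
  with \<open>i\<close>.\<close>

lemma fun_det_powi_pos:
  assumes "1 < Q" "incr n i" "incr n e"
  shows "0 < fun_det n (\<lambda>k l. Q powi (i k * e l))"
  using assms(2,3)
proof (induction n arbitrary: i e)
  case (Suc n)
  have Q: "0 < Q" using assms(1) by simp
  define d where "d = (\<lambda>l. e l - e 0)"
  have d_pos: "0 < d (Suc l)" if "l < n" for l
    using incrD[OF Suc.prems(2), of 0 "Suc l"] that by (simp add: d_def)
  have i_less: "i k < i (Suc k)" if "k < n" for k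
    using incrD[OF Suc.prems(1), of k "Suc k"] that by simp
  define f where "f = (\<lambda>k l. Q powi (i k * d l))"
  define f' where "f' = (\<lambda>k l. if k = 0 then f 0 l else f k l - f (k - 1) l)"
  have "fun_det (Suc n) (\<lambda>k l. Q powi (i k * e l)) = fun_det (Suc n) (\<lambda>k l. Q powi (i k * e 0) * f k l)"
  proof (rule fun_det_cong)
    fix k l
    have "Q powi (i k * e l) = Q powi (i k * e 0 + i k * d l)"
      by (rule arg_cong[where f = "\<lambda>x. Q powi x"]) (simp add: d_def algebra_simps)
    then show "Q powi (i k * e l) = Q powi (i k * e 0) * f k l"
      using Q by (simp add: f_def power_int_add)
  qed
  also have "\<dots> = (\<Prod>k = 0..<Suc n. Q powi (i k * e 0)) * fun_det (Suc n) f"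
    by (rule fun_det_scale_rows)
  also have "fun_det (Suc n) f = fun_det (Suc n) f'"
    by (rule fun_det_row_diff[symmetric, where c = "\<lambda>_. 1"]) (auto simp: f'_def)
  also have "\<dots> = fun_det n (\<lambda>k l. f' (Suc k) (Suc l))"
    by (rule fun_det_first_col) (auto simp: f'_def f_def d_def)
  also have "\<dots> = fun_det n (\<lambda>k l. (Q powi d (Suc l) - 1) * (\<Sum>m\<in>{i k..<i (Suc k)}. Q powi (m * d (Suc l))))"
  proof (rule fun_det_cong)
    fix k l assume "k < n" "l < n"
    have "f' (Suc k) (Suc l) = (\<Sum>m\<in>{i k..<i (Suc k)}. Q powi ((m + 1) * d (Suc l)) - Q powi (m * d (Suc l)))"
      using sum_telescope_int[of "i k" "i (Suc k)" "\<lambda>m. Q powi (m * d (Suc l))"] i_less[OF \<open>k < n\<close>]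
      by (simp add: f'_def f_def)
    also have "\<dots> = (\<Sum>m\<in>{i k..<i (Suc k)}. (Q powi d (Suc l) - 1) * Q powi (m * d (Suc l)))"
      using Q by (intro sum.cong) (auto simp: distrib_right power_int_add algebra_simps)
    finally show "f' (Suc k) (Suc l) = (Q powi d (Suc l) - 1) * (\<Sum>m\<in>{i k..<i (Suc k)}. Q powi (m * d (Suc l)))"
      by (simp add: sum_distrib_left)
  qed
  also have "\<dots> = (\<Prod>l = 0..<n. Q powi d (Suc l) - 1) * fun_det n (\<lambda>k l. \<Sum>m\<in>{i k..<i (Suc k)}. Q powi (m * d (Suc l)))"
    by (rule fun_det_scale_cols)
  also have "fun_det n (\<lambda>k l. \<Sum>m\<in>{i k..<i (Suc k)}. Q powi (m * d (Suc l)))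
     = (\<Sum>g\<in>Pi\<^sub>E {0..<n} (\<lambda>k. {i k..<i (Suc k)}). (\<Prod>k = 0..<n. 1) * fun_det n (\<lambda>k l. Q powi (g k * d (Suc l))))"
    by (rule fun_det_expand_rows) auto
  finally have eq: "fun_det (Suc n) (\<lambda>k l. Q powi (i k * e l)) = (\<Prod>k = 0..<Suc n. Q powi (i k * e 0)) *
     ((\<Prod>l = 0..<n. Q powi d (Suc l) - 1) *
     (\<Sum>g\<in>Pi\<^sub>E {0..<n} (\<lambda>k. {i k..<i (Suc k)}). fun_det n (\<lambda>k l. Q powi (g k * d (Suc l)))))"
    by simp
  have "0 < (\<Sum>g\<in>Pi\<^sub>E {0..<n} (\<lambda>k. {i k..<i (Suc k)}). fun_det n (\<lambda>k l. Q powi (g k * d (Suc l))))"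
  proof (rule sum_pos)
    show "finite (Pi\<^sub>E {0..<n} (\<lambda>k. {i k..<i (Suc k)}))" by (rule finite_PiE) auto
    show "Pi\<^sub>E {0..<n} (\<lambda>k. {i k..<i (Suc k)}) \<noteq> {}"
      using i_less by (subst PiE_eq_empty_iff) force
    fix g assume g: "g \<in> Pi\<^sub>E {0..<n} (\<lambda>k. {i k..<i (Suc k)})"
    show "0 < fun_det n (\<lambda>k l. Q powi (g k * d (Suc l)))"
    proof (rule Suc.IH)
      show "incr n g"
      proof (rule incrI)
        fix k l assume kl: "k < l" "l < n"
        have "g k < i (Suc k)" "i l \<le> g l" using g kl by (auto simp: PiE_iff)
        moreover have "i (Suc k) \<le> i l"
          using incrD[OF Suc.prems(1), of "Suc k" l] kl by (cases "Suc k = l") auto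
        ultimately show "g k < g l" by simp
      qed
      show "incr n (\<lambda>l. d (Suc l))"
        by (rule incrI) (use incrD[OF Suc.prems(2)] in \<open>auto simp: d_def\<close>)
    qed
  qed
  moreover have "0 < Q powi d (Suc l) - 1" if "l < n" for l
    using d_pos[OF that] assms(1) by (simp add: one_less_power_int)
  ultimately show ?case
    unfolding eq using Q by (intro mult_pos_pos prod_pos) auto
qed simp

text \<open>Since (i - j)^2 = i^2 + j^2 - 2 i j, the kernel is, up to positive row and column
  factors, a generalized Vandermonde kernel to the base 1 / q^2 > 1.\<close>

lemma tp_pfs_gaussian:
  assumes q: "0 < q" "q < 1" and r: "0 < r" and x: "0 < x"
  shows "tp_polya_frequency_sequence (\<lambda>n. x * r powi n * q powi (n * n))"
  unfolding tp_pfs_iff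
proof (intro allI impI)
  fix n i j assume ij: "incr n i" "incr n j"
  have "toeplitz_minor (\<lambda>n. x * r powi n * q powi (n * n)) n i j =
    fun_det n (\<lambda>k l. (x * r powi i k * q powi (i k * i k)) * ((r powi (- j l) * q powi (j l * j l)) * (1 / q\<^sup>2) powi (i k * j l)))"
    unfolding toeplitz_minor_def
  proof (rule fun_det_cong)
    fix k l
    have "(1 / q\<^sup>2) powi (i k * j l) = q powi (- 2 * (i k * j l))"
      unfolding power_int_mult[of q "- 2"] by (simp add: power_int_minus inverse_eq_divide)
    moreover have "r powi (i k - j l) = r powi i k * r powi (- j l)"
      using r by (simp flip: power_int_add)
    moreover have "q powi ((i k - j l) * (i k - j l)) = q powi (i k * i k) * q powi (j l * j l) * q powi (- 2 * (i k * j l))"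
      using q by (simp add: algebra_simps flip: power_int_add)
    ultimately show "x * r powi (i k - j l) * q powi ((i k - j l) * (i k - j l)) =
      (x * r powi i k * q powi (i k * i k)) * ((r powi (- j l) * q powi (j l * j l)) * (1 / q\<^sup>2) powi (i k * j l))"
      by simp
  qed
  also have "\<dots> = (\<Prod>k = 0..<n. x * r powi i k * q powi (i k * i k)) *
     ((\<Prod>l = 0..<n. r powi (- j l) * q powi (j l * j l)) * fun_det n (\<lambda>k l. (1 / q\<^sup>2) powi (i k * j l)))"
    by (simp only: fun_det_scale_rows fun_det_scale_cols)
  also have "\<dots> > 0"
    using q r x by (intro mult_pos_pos prod_pos fun_det_powi_pos ij) (auto simp: power_less_one_iff)
  finally show "0 < toeplitz_minor (\<lambda>n. x * r powi n * q powi (n * n)) n i j" .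
qed

lemma incr_1: "incr (Suc 0) i"
  by (auto simp: strict_mono_on_def)

lemma pfs_nonneg:
  assumes "polya_frequency_sequence a"
  shows "0 \<le> a n"
proof -
  have "0 \<le> toeplitz_minor a (Suc 0) (\<lambda>_. n) (\<lambda>_. 0)"
    using assms incr_1 by (simp add: pfs_iff)
  then show ?thesis by (simp add: toeplitz_minor_def fun_det_1)
qed

lemma pfs_scale: "polya_frequency_sequence a \<Longrightarrow> 0 \<le> c \<Longrightarrow> polya_frequency_sequence (\<lambda>n. c * a n)"
  by (simp add: pfs_iff toeplitz_minor_scale)

lemma incr_add: "incr n i \<Longrightarrow> incr n (\<lambda>k. i k + s)"
  by (auto simp: strict_mono_on_def)

lemma pfs_shift: "polya_frequency_sequence a \<Longrightarrow> polya_frequency_sequence (\<lambda>n. a (n + s))"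
  by (simp add: pfs_iff toeplitz_minor_shift incr_add)

section \<open>Smoothing\<close>

lemma incr_min:
  assumes i: "incr n i" and j: "incr n j"
  shows "incr n (\<lambda>k. min (i k) (j k))"
proof (rule incrI)
  fix k l assume "k < l" "l < n"
  from incrD[OF i this] incrD[OF j this] show "min (i k) (j k) < min (i l) (j l)" by linarith
qed

text \<open>Shifting the argument by 1 costs at most a factor \<open>R\<close> in this bound, which
  keeps the infinite product of smoothing factors convergent.\<close>

definition exp_bounded :: "real \<Rightarrow> real \<Rightarrow> (int \<Rightarrow> real) \<Rightarrow> bool" where
  "exp_bounded C R a \<longleftrightarrow> 1 \<le> R \<and> (\<forall>n. a n \<le> C * R ^ nat \<bar>n\<bar>)"

text \<open>Multiplication of the generating function by \<open>\<Prod>m<k. 1 + \<epsilon> z / 2\<^sup>m\<close>. No minor ever decreases, and each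
  factor can move any set of rows up by one, so in the limit a minor is positive as soon as some minor with
  smaller row indices is.\<close>

primrec smoothed :: "real \<Rightarrow> (int \<Rightarrow> real) \<Rightarrow> nat \<Rightarrow> int \<Rightarrow> real" where
  "smoothed \<epsilon> a 0 = a"
| "smoothed \<epsilon> a (Suc k) = (\<lambda>n. smoothed \<epsilon> a k n + \<epsilon> / 2 ^ k * smoothed \<epsilon> a k (n - 1))"

lemma sum_inverse_powers_le_2: "(\<Sum>m<k. 1 / 2 ^ m) \<le> (2 :: real)"
proof -
  have "(\<Sum>m<k. 1 / 2 ^ m) = (2 :: real) - 2 / 2 ^ k" for k :: nat
    by (induction k) (auto simp: field_simps)
  then show ?thesis by simp
qed

context
  fixes a :: "int \<Rightarrow> real" and \<epsilon> C R :: real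
  assumes pf: "polya_frequency_sequence a" and \<epsilon>: "0 < \<epsilon>" "\<epsilon> \<le> 1" and bd: "exp_bounded C R a"
begin

lemma pfs_smoothed: "polya_frequency_sequence (smoothed \<epsilon> a k)"
proof (induction k)
  case (Suc k)
  then show ?case
    by (rule pfs_linear_factor[where \<alpha> = "\<epsilon> / 2 ^ k"]) (use \<epsilon> in auto)
qed (simp add: pf)

lemma R_ge_1: "1 \<le> R" and C_nonneg: "0 \<le> C"
proof -
  show "1 \<le> R" using bd by (simp add: exp_bounded_def)
  have "0 \<le> a 0" "a 0 \<le> C * R ^ nat \<bar>0\<bar>"
    using bd pfs_nonneg[OF pf] unfolding exp_bounded_def by blast+
  then show "0 \<le> C" by simp
qed

lemma power_abs_pred_le: "R ^ nat \<bar>n - 1\<bar> \<le> R * R ^ nat \<bar>n\<bar>"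
proof -
  have "R ^ nat \<bar>n - 1\<bar> \<le> R ^ Suc (nat \<bar>n\<bar>)"
    by (rule power_increasing) (use R_ge_1 in auto)
  then show ?thesis by simp
qed

text \<open>As \<epsilon> \<le> 1, factor number \<open>k\<close> enlarges the bound by at most
  \<open>1 + R / 2 ^ k \<le> exp (R / 2 ^ k)\<close>, and the exponents add up to at most
  \<open>2 * R\<close>.\<close>

lemma smoothed_bound: "smoothed \<epsilon> a k n \<le> C * exp (2 * R) * R ^ nat \<bar>n\<bar>"
proof -
  have *: "smoothed \<epsilon> a k n \<le> C * exp (R * (\<Sum>m<k. 1 / 2 ^ m)) * R ^ nat \<bar>n\<bar>" for k
  proof (induction k arbitrary: n)
    case 0
    then show ?case using bd by (simp add: exp_bounded_def)
  next
    case (Suc k)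
    define E where "E = C * exp (R * (\<Sum>m<k. 1 / 2 ^ m))"
    have E: "0 \<le> E" using C_nonneg by (simp add: E_def)
    have "smoothed \<epsilon> a (Suc k) n \<le> E * R ^ nat \<bar>n\<bar> + 1 / 2 ^ k * (E * (R * R ^ nat \<bar>n\<bar>))"
      unfolding smoothed.simps
    proof (intro add_mono mult_mono)
      show "smoothed \<epsilon> a k n \<le> E * R ^ nat \<bar>n\<bar>" using Suc by (simp add: E_def)
      show "smoothed \<epsilon> a k (n - 1) \<le> E * (R * R ^ nat \<bar>n\<bar>)"
        by (rule order_trans[OF Suc[of "n - 1", folded E_def] mult_left_mono[OF power_abs_pred_le E]])
    qed (use \<epsilon> pfs_nonneg[OF pfs_smoothed] in \<open>auto simp: divide_right_mono\<close>)
    also have "\<dots> = E * (1 + R / 2 ^ k) * R ^ nat \<bar>n\<bar>" by (simp add: field_simps)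
    also have "\<dots> \<le> E * exp (R / 2 ^ k) * R ^ nat \<bar>n\<bar>"
      using E R_ge_1 by (intro mult_right_mono mult_left_mono exp_ge_add_one_self) auto
    also have "E * exp (R / 2 ^ k) = C * exp (R * (\<Sum>m<Suc k. 1 / 2 ^ m))"
      by (simp add: E_def distrib_left flip: exp_add)
    finally show ?case .
  qed
  also have "C * exp (R * (\<Sum>m<k. 1 / 2 ^ m)) * R ^ nat \<bar>n\<bar> \<le> C * exp (R * 2) * R ^ nat \<bar>n\<bar>"
    using C_nonneg R_ge_1 sum_inverse_powers_le_2[of k] by (intro mult_right_mono mult_left_mono) auto
  finally show ?thesis by (simp add: mult.commute)
qed

text \<open>The error does not depend on \<open>k\<close> and is linear in \<epsilon>, so it
  survives the limit over \<open>k\<close> and disappears as \<epsilon> tends to 0.\<close>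

lemma smoothed_close: "smoothed \<epsilon> a k n \<le> a n + \<epsilon> * (2 * R * (C * exp (2 * R))) * R ^ nat \<bar>n\<bar>"
proof -
  define B where "B = C * exp (2 * R) * (R * R ^ nat \<bar>n\<bar>)"
  have B: "0 \<le> B" using C_nonneg R_ge_1 by (simp add: B_def)
  have "smoothed \<epsilon> a k n \<le> a n + \<epsilon> * B * (\<Sum>m<k. 1 / 2 ^ m)"
  proof (induction k)
    case (Suc k)
    have "smoothed \<epsilon> a k (n - 1) \<le> B"
      unfolding B_def by (rule order_trans[OF smoothed_bound mult_left_mono[OF power_abs_pred_le]]) (simp add: C_nonneg)
    then have "\<epsilon> / 2 ^ k * smoothed \<epsilon> a k (n - 1) \<le> \<epsilon> / 2 ^ k * B"
      using \<epsilon> by (intro mult_left_mono) auto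
    with Suc show ?case by (simp add: distrib_left)
  qed simp
  also have "\<dots> \<le> a n + \<epsilon> * B * 2"
    using sum_inverse_powers_le_2[of k] B \<epsilon> by (intro add_left_mono mult_left_mono) auto
  finally show ?thesis by (simp add: B_def mult_ac)
qed

lemma smoothed_incseq: "incseq (\<lambda>k. smoothed \<epsilon> a k n)"
  by (rule incseq_SucI) (use \<epsilon> pfs_nonneg[OF pfs_smoothed] in simp)

lemma toeplitz_minor_smoothed_incseq: "incr n i \<Longrightarrow> incr n j \<Longrightarrow> incseq (\<lambda>k. toeplitz_minor (smoothed \<epsilon> a k) n i j)"
  by (rule incseq_SucI, rule toeplitz_minor_linear_factor_mono[OF pfs_smoothed, where \<alpha> = "\<epsilon> / 2 ^ _"]) (use \<epsilon> in auto)

lemma toeplitz_minor_smoothed_pos: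
  assumes i: "incr n i" and j: "incr n j" and i': "incr n i'"
    and le: "\<And>k. k < n \<Longrightarrow> i' k \<le> i k" and pos: "0 < toeplitz_minor a n i' j"
  shows "\<exists>t. 0 < toeplitz_minor (smoothed \<epsilon> a t) n i j"
proof -
  \<comment> \<open>Each row climbs from \<open>i' k\<close> by at most one per factor and stops at
    \<open>i k\<close>; a minimum of two increasing tuples is increasing, so all intermediate tuples
    are admissible.\<close>
  define p where "p = (\<lambda>t k. min (i' k + int t) (i k))"
  have p: "incr n (p t)" for t
    unfolding p_def by (intro incr_min incr_add i i')
  have pos_p: "0 < toeplitz_minor (smoothed \<epsilon> a t) n (p t) j" for t
  proof (induction t)
    case 0
    have "toeplitz_minor a n (p 0) j = toeplitz_minor a n i' j" by (rule toeplitz_minor_cong) (use le in \<open>auto simp: p_def\<close>)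
    then show ?case using pos by simp
  next
    case (Suc t)
    have "0 < (\<Prod>k = 0..<n. if p t k = p (Suc t) k then 1 else \<epsilon> / 2 ^ t) * toeplitz_minor (smoothed \<epsilon> a t) n (p t) j"
      using Suc \<epsilon> by (intro mult_pos_pos prod_pos) auto
    also have "\<dots> \<le> toeplitz_minor (smoothed \<epsilon> a (Suc t)) n (p (Suc t)) j"
    proof (rule toeplitz_minor_linear_factor_ge[OF pfs_smoothed _ _ p j])
      show "p t k \<in> {p (Suc t) k - 1, p (Suc t) k}" for k by (auto simp: p_def min_def)
    qed (use \<epsilon> in auto)
    finally show ?case .
  qed
  define T where "T = (\<Sum>k<n. nat (i k - i' k))"
  have "p T k = i k" if "k < n" for k
  proof -
    have "nat (i k - i' k) \<le> T"
      unfolding T_def using that by (intro member_le_sum) auto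
    then show ?thesis by (simp add: p_def)
  qed
  then have "toeplitz_minor (smoothed \<epsilon> a T) n (p T) j = toeplitz_minor (smoothed \<epsilon> a T) n i j"
    by (intro toeplitz_minor_cong) auto
  with pos_p[of T] show ?thesis by auto
qed

text \<open>\<open>c\<close> belongs to the infinite product. Since the minors increase along the
  partial products, a minor that is positive at a finite stage remains positive in the
  limit.\<close>

lemma smoothing:
  obtains c where "polya_frequency_sequence c" "\<And>n. a n \<le> c n"
    "\<And>n. c n \<le> a n + \<epsilon> * (2 * R * (C * exp (2 * R))) * R ^ nat \<bar>n\<bar>"
    "\<And>n i j i'. incr n i \<Longrightarrow> incr n j \<Longrightarrow> incr n i' \<Longrightarrow> (\<And>k. k < n \<Longrightarrow> i' k \<le> i k) \<Longrightarrow>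
       0 < toeplitz_minor a n i' j \<Longrightarrow> 0 < toeplitz_minor c n i j"
proof -
  have "\<exists>L. (\<lambda>k. smoothed \<epsilon> a k n) \<longlonglongrightarrow> L" for n
    using incseq_convergent[OF smoothed_incseq[of n]] smoothed_bound[of _ n] by metis
  then obtain c where c: "\<And>n. (\<lambda>k. smoothed \<epsilon> a k n) \<longlonglongrightarrow> c n" by metis
  show ?thesis
  proof (rule that)
    show "polya_frequency_sequence c" by (rule pfs_limit[OF pfs_smoothed c])
    show "a n \<le> c n" for n using incseq_le[OF smoothed_incseq c, of 0 n] by simp
    show "c n \<le> a n + \<epsilon> * (2 * R * (C * exp (2 * R))) * R ^ nat \<bar>n\<bar>" for n
      by (rule LIMSEQ_le_const2[OF c]) (use smoothed_close in blast)
    fix n i j i'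
    assume ij: "incr n i" "incr n j" "incr n i'" "\<And>k. k < n \<Longrightarrow> i' k \<le> i k" "0 < toeplitz_minor a n i' j"
    then obtain t where "0 < toeplitz_minor (smoothed \<epsilon> a t) n i j" using toeplitz_minor_smoothed_pos by blast
    also have "\<dots> \<le> toeplitz_minor c n i j"
      by (rule incseq_le[OF toeplitz_minor_smoothed_incseq[OF ij(1,2)] toeplitz_minor_tendsto[OF c]])
    finally show "0 < toeplitz_minor c n i j" .
  qed
qed

end

text \<open>All test sequences lie in this class. Its members are Polya frequency sequences, and a
  preserver of total positivity, extended continuously to 0, maps them to Polya frequency sequences,
  so both parts of the theorem share one classification.\<close>

definition tp_limit :: "(int \<Rightarrow> real) \<Rightarrow> bool" where
  "tp_limit a \<longleftrightarrow> (\<exists>A :: nat \<Rightarrow> int \<Rightarrow> real.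
     (\<forall>m. tp_polya_frequency_sequence (A m)) \<and> (\<forall>n. (\<lambda>m. A m n) \<longlonglongrightarrow> a n))"

text \<open>Smoothing by factors in \<open>z\<close> and then in \<open>1 / z\<close> makes such a sequence totally positive: from
  \<open>i = j + s\<close> all pairs of index tuples can be reached.\<close>

definition nondegenerate :: "(int \<Rightarrow> real) \<Rightarrow> bool" where
  "nondegenerate a \<longleftrightarrow> polya_frequency_sequence a \<and>
     (\<exists>s. \<forall>n j. incr n j \<longrightarrow> 0 < toeplitz_minor a n (\<lambda>k. j k + s) j)"

lemma tp_limit_nondegenerate:
  assumes "nondegenerate a" "exp_bounded C R a"
  shows "tp_limit a"
proof -
  obtain s where pf: "polya_frequency_sequence a" and s: "\<And>n j. incr n j \<Longrightarrow> 0 < toeplitz_minor a n (\<lambda>k. j k + s) j"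
    using assms(1) unfolding nondegenerate_def by blast
  define K where "K = 2 * R * (C * exp (2 * R))"
  define K' where "K' = 2 * R * ((C + K) * exp (2 * R))"
  have R: "1 \<le> R" and C: "0 \<le> C" using R_ge_1[OF pf _ _ assms(2), of 1] C_nonneg[OF pf _ _ assms(2), of 1] by auto
  have K: "0 \<le> K" using R C by (simp add: K_def)
  have "\<exists>d. tp_polya_frequency_sequence d \<and> (\<forall>n. a n \<le> d n \<and> d n \<le> a n + \<epsilon> * ((K + K') * R ^ nat \<bar>n\<bar>))"
    if \<epsilon>: "0 < \<epsilon>" "\<epsilon> \<le> 1" for \<epsilon>
  proof -
    from smoothing[OF pf \<epsilon> assms(2)] obtain c where c: "polya_frequency_sequence c" "\<And>n. a n \<le> c n"
      "\<And>n. c n \<le> a n + \<epsilon> * K * R ^ nat \<bar>n\<bar>"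
      and c_pos: "\<And>n i j i'. incr n i \<Longrightarrow> incr n j \<Longrightarrow> incr n i' \<Longrightarrow> (\<And>k. k < n \<Longrightarrow> i' k \<le> i k) \<Longrightarrow>
       0 < toeplitz_minor a n i' j \<Longrightarrow> 0 < toeplitz_minor c n i j"
      unfolding K_def by metis
    \<comment> \<open>The reflected sequence is smoothed next, which amounts to factors in
      \<open>1 / z\<close>. The first smoothing raises the growth constant to at most
      \<open>C + K\<close>.\<close>
    have "exp_bounded (C + K) R (\<lambda>n. c (- n))"
      unfolding exp_bounded_def
    proof (intro conjI allI R)
      fix n
      have "c (- n) \<le> C * R ^ nat \<bar>n\<bar> + \<epsilon> * K * R ^ nat \<bar>n\<bar>"
        using c(3)[of "- n"] assms(2)[unfolded exp_bounded_def, THEN conjunct2, rule_format, of "- n"] by simp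
      also have "\<dots> \<le> C * R ^ nat \<bar>n\<bar> + 1 * K * R ^ nat \<bar>n\<bar>"
        using \<epsilon> K R by (intro add_left_mono mult_right_mono) auto
      finally show "c (- n) \<le> (C + K) * R ^ nat \<bar>n\<bar>" by (simp add: distrib_right)
    qed
    from smoothing[OF pfs_reflect[OF c(1)] \<epsilon> this] obtain d where d: "polya_frequency_sequence d" "\<And>n. c (- n) \<le> d n"
      "\<And>n. d n \<le> c (- n) + \<epsilon> * K' * R ^ nat \<bar>n\<bar>"
      and d_pos: "\<And>n i j i'. incr n i \<Longrightarrow> incr n j \<Longrightarrow> incr n i' \<Longrightarrow> (\<And>k. k < n \<Longrightarrow> i' k \<le> i k) \<Longrightarrow>
       0 < toeplitz_minor (\<lambda>n. c (- n)) n i' j \<Longrightarrow> 0 < toeplitz_minor d n i j"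
      unfolding K'_def by metis
    show ?thesis
    proof (intro exI[of _ "\<lambda>n. d (- n)"] conjI allI)
      show "tp_polya_frequency_sequence (\<lambda>n. d (- n))"
        unfolding tp_pfs_iff toeplitz_minor_reflect
      proof (intro allI impI)
        fix n i j assume ij: "incr n i" "incr n j"
        \<comment> \<open>\<open>j'\<close> lies below both \<open>j\<close> and
          \<open>i - s\<close>. Starting from rows \<open>j' + s\<close> and columns
          \<open>j'\<close>, the first smoothing raises the rows to \<open>i\<close> and the second
          one the columns to \<open>j\<close>.\<close>
        define j' where "j' = (\<lambda>k. min (j k) (i k - s))"
        have j': "incr n j'"
          unfolding j'_def using incr_min[OF ij(2) incr_add[OF ij(1), of "- s"]] by simp
        have "0 < toeplitz_minor c n i j'"
          by (rule c_pos[OF ij(1) j' incr_add[OF j'] _ s[OF j']]) (auto simp: j'_def)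
        then show "0 < toeplitz_minor d n j i"
          by (intro d_pos[OF ij(2,1) j']) (auto simp: j'_def toeplitz_minor_reflect)
      qed
      show "a n \<le> d (- n)" for n using c(2)[of n] d(2)[of "- n"] by simp
      show "d (- n) \<le> a n + \<epsilon> * ((K + K') * R ^ nat \<bar>n\<bar>)" for n
        using c(3)[of n] d(3)[of "- n"] by (simp add: algebra_simps)
    qed
  qed
  from this[of "1 / real (Suc _)"] have "\<forall>m. \<exists>d. tp_polya_frequency_sequence d \<and>
     (\<forall>n. a n \<le> d n \<and> d n \<le> a n + 1 / real (Suc m) * ((K + K') * R ^ nat \<bar>n\<bar>))"
    by simp
  then obtain A where A: "\<And>m. tp_polya_frequency_sequence (A m)"
    "\<And>m n. a n \<le> A m n" "\<And>m n. A m n \<le> a n + 1 / real (Suc m) * ((K + K') * R ^ nat \<bar>n\<bar>)"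
    by metis
  have "(\<lambda>m. A m n) \<longlonglongrightarrow> a n" for n
  proof (rule tendsto_sandwich[where f = "\<lambda>_. a n"])
    have "(\<lambda>m. a n + 1 / real (Suc m) * ((K + K') * R ^ nat \<bar>n\<bar>)) \<longlonglongrightarrow> a n + 0 * ((K + K') * R ^ nat \<bar>n\<bar>)"
      by (intro tendsto_intros LIMSEQ_Suc[OF lim_1_over_n])
    then show "(\<lambda>m. a n + 1 / real (Suc m) * ((K + K') * R ^ nat \<bar>n\<bar>)) \<longlonglongrightarrow> a n" by simp
  qed (use A in \<open>auto intro!: always_eventually simp del: of_nat_Suc\<close>)
  with A(1) show ?thesis unfolding tp_limit_def by blast
qed

section \<open>Closure properties of nondegenerate sequences\<close>

lemma nondegenerate_mono:
  assumes "nondegenerate a" "\<And>n i j. incr n i \<Longrightarrow> incr n j \<Longrightarrow> toeplitz_minor a n i j \<le> toeplitz_minor b n i j"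
  shows "nondegenerate b"
proof -
  obtain s where pf: "polya_frequency_sequence a" and s: "\<And>n j. incr n j \<Longrightarrow> 0 < toeplitz_minor a n (\<lambda>k. j k + s) j"
    using assms(1) unfolding nondegenerate_def by blast
  have "polya_frequency_sequence b"
    using pf assms(2) unfolding pfs_iff by (meson order_trans)
  moreover have "0 < toeplitz_minor b n (\<lambda>k. j k + s) j" if "incr n j" for n j
    using s[OF that] assms(2)[OF incr_add[OF that] that] by (rule order.strict_trans2)
  ultimately show ?thesis unfolding nondegenerate_def by blast
qed

lemma nondegenerate_linear_factor:
  assumes "nondegenerate a" "0 \<le> \<alpha>" "\<And>n. b n = a n + \<alpha> * a (n - 1)"
  shows "nondegenerate b"
proof (rule nondegenerate_mono[OF assms(1)])
  have "polya_frequency_sequence a" using assms(1) by (simp add: nondegenerate_def)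
  then show "toeplitz_minor a n i j \<le> toeplitz_minor b n i j" if "incr n i" "incr n j" for n i j
    using toeplitz_minor_linear_factor_mono[of a \<alpha> b, OF _ assms(2,3) that] by simp
qed

lemma nondegenerate_geometric_factor:
  assumes "nondegenerate a" "0 \<le> \<alpha>" "\<And>n. c n = \<alpha> * c (n - 1) + a n"
    "\<And>n. (\<lambda>M. \<alpha> ^ M * c (n - int M)) \<longlonglongrightarrow> 0"
  shows "nondegenerate c"
proof (rule nondegenerate_mono[OF assms(1)])
  have "polya_frequency_sequence a" using assms(1) by (simp add: nondegenerate_def)
  then show "toeplitz_minor a n i j \<le> toeplitz_minor c n i j" if "incr n i" "incr n j" for n i j
    using toeplitz_minor_geometric_factor_mono[of a \<alpha> c, OF _ assms(2-4) that] by simp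
qed

lemma nondegenerate_reflect:
  assumes "nondegenerate a"
  shows "nondegenerate (\<lambda>n. a (- n))"
proof -
  obtain s where s: "\<And>n j. incr n j \<Longrightarrow> 0 < toeplitz_minor a n (\<lambda>k. j k + s) j"
    using assms unfolding nondegenerate_def by blast
  have "0 < toeplitz_minor (\<lambda>n. a (- n)) n (\<lambda>k. j k + - s) j" if "incr n j" for n j
    using s[OF incr_add[OF that, of "- s"]] by (simp add: toeplitz_minor_reflect)
  then show ?thesis using assms pfs_reflect unfolding nondegenerate_def by blast
qed

lemma nondegenerate_scale:
  assumes "nondegenerate a" "0 < c"
  shows "nondegenerate (\<lambda>n. c * a n)"
proof -
  obtain s where "\<And>n j. incr n j \<Longrightarrow> 0 < toeplitz_minor a n (\<lambda>k. j k + s) j"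
    using assms(1) unfolding nondegenerate_def by blast
  then have "0 < toeplitz_minor (\<lambda>n. c * a n) n (\<lambda>k. j k + s) j" if "incr n j" for n j
    using that assms(2) by (simp add: toeplitz_minor_scale)
  moreover have "polya_frequency_sequence (\<lambda>n. c * a n)"
    using assms by (intro pfs_scale) (auto simp: nondegenerate_def)
  ultimately show ?thesis unfolding nondegenerate_def by blast
qed

lemma nondegenerate_delta: "nondegenerate (\<lambda>n. if n = 0 then 1 else 0)"
proof -
  have "toeplitz_minor (\<lambda>n. if n = 0 then 1 else 0) n j j = 1" if j: "incr n j" for n j
  proof -
    have "mat n n (\<lambda>(k, l). if j k - j l = 0 then 1 else 0) = (1\<^sub>m n :: real mat)"
      using strict_mono_on_imp_inj_on[OF j] by (intro eq_matI) (auto simp: inj_on_def)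
    then show ?thesis by (simp add: toeplitz_minor_def fun_det_def)
  qed
  then show ?thesis unfolding nondegenerate_def using pfs_delta by (intro conjI exI[of _ 0]) auto
qed

section \<open>Test sequences\<close>

text \<open>The generating function is x (1 + \<gamma> z) (1 + z / \<gamma>) with \<gamma> + 1 /
  \<gamma> = y / x; the condition on \<open>y\<close> lets \<gamma> be real and positive.\<close>

lemma tp_limit_three_terms:
  assumes "0 < x" "2 * x \<le> y"
  shows "tp_limit (\<lambda>n. if n = 0 \<or> n = 2 then x else if n = 1 then y else 0)"
proof -
  define t where "t = y / x"
  define \<gamma> where "\<gamma> = (t + sqrt (t\<^sup>2 - 4)) / 2"
  have t: "2 \<le> t" using assms by (simp add: t_def field_simps)
  then have "2\<^sup>2 \<le> t\<^sup>2" by (intro power_mono) auto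
  then have sq: "(sqrt (t\<^sup>2 - 4))\<^sup>2 = t\<^sup>2 - 4" "0 \<le> sqrt (t\<^sup>2 - 4)" by auto
  have \<gamma>: "0 < \<gamma>" unfolding \<gamma>_def using t by (intro divide_pos_pos add_pos_nonneg sq(2)) auto
  have "\<gamma>\<^sup>2 + 1 = t * \<gamma>"
    using sq(1) by (simp add: \<gamma>_def power2_eq_square field_simps)
  then have \<gamma>_eq: "\<gamma> + 1 / \<gamma> = t" using \<gamma> by (simp add: field_simps power2_eq_square)
  define d :: "int \<Rightarrow> real" where "d = (\<lambda>n. if n = 0 then 1 else 0)"
  define a where "a = (\<lambda>n. d n + \<gamma> * d (n - 1))"
  define b where "b = (\<lambda>n. a n + 1 / \<gamma> * a (n - 1))"
  have "nondegenerate a"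
    by (rule nondegenerate_linear_factor[where \<alpha> = \<gamma>, OF nondegenerate_delta[folded d_def]]) (use \<gamma> in \<open>auto simp: a_def\<close>)
  then have "nondegenerate b"
    by (rule nondegenerate_linear_factor[where \<alpha> = "1 / \<gamma>"]) (use \<gamma> in \<open>auto simp: b_def\<close>)
  then have "nondegenerate (\<lambda>n. x * b n)"
    using assms(1) by (rule nondegenerate_scale)
  moreover have "(\<lambda>n. x * b n) = (\<lambda>n. if n = 0 \<or> n = 2 then x else if n = 1 then y else 0)"
  proof
    fix n :: int
    have "x * (\<gamma> + 1 / \<gamma>) = y" using assms by (simp add: \<gamma>_eq t_def)
    then show "x * b n = (if n = 0 \<or> n = 2 then x else if n = 1 then y else 0)"
      using \<gamma> by (auto simp: b_def a_def d_def)
  qed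
  ultimately have "nondegenerate (\<lambda>n. if n = 0 \<or> n = 2 then x else if n = 1 then y else 0)" by simp
  then show ?thesis
    by (rule tp_limit_nondegenerate[of _ "x + y" 1]) (use assms in \<open>auto simp: exp_bounded_def\<close>)
qed

lemma vanishing_left_tail:
  fixes c :: "int \<Rightarrow> real"
  assumes "\<And>n. n < s \<Longrightarrow> c n = 0"
  shows "(\<lambda>M. \<alpha> ^ M * c (n - int M)) \<longlonglongrightarrow> 0"
proof (rule tendsto_eventually)
  have "\<forall>\<^sub>F M in sequentially. nat (n - s) < M" by (rule eventually_gt_at_top)
  then show "\<forall>\<^sub>F M in sequentially. \<alpha> ^ M * c (n - int M) = 0"
    by eventually_elim (use assms in auto)
qed

text \<open>Division by 1 - z. Iterated from the unit sequence it yields 1 / (1 - z), 1 / (1 - z)^2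
  and 1 / (1 - z)^3.\<close>

lemma nondegenerate_partial_sums:
  assumes "nondegenerate a" "\<And>n. c n = c (n - 1) + a n" "\<And>n. n < 0 \<Longrightarrow> c n = 0"
  shows "nondegenerate c"
proof (rule nondegenerate_geometric_factor[OF assms(1), of 1])
  show "c n = 1 * c (n - 1) + a n" for n using assms(2)[of n] by simp
  show "(\<lambda>M. 1 ^ M * c (n - int M)) \<longlonglongrightarrow> 0" for n
    using assms(3) by (rule vanishing_left_tail)
qed simp

lemma nondegenerate_step: "nondegenerate (\<lambda>n. if 0 \<le> n then 1 else 0)"
  by (rule nondegenerate_partial_sums[OF nondegenerate_delta]) auto

lemma nondegenerate_ramp: "nondegenerate (\<lambda>n. real_of_int (max 0 (n + 1)))"
  by (rule nondegenerate_partial_sums[OF nondegenerate_step]) auto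

lemma nondegenerate_triangular:
  "nondegenerate (\<lambda>n. if - 1 \<le> n then real_of_int ((n + 1) * (n + 2)) / 2 else 0)"
proof (rule nondegenerate_partial_sums[OF nondegenerate_ramp])
  fix n :: int
  consider "n < - 1" | "n = - 1" | "0 \<le> n" by linarith
  then show "(if - 1 \<le> n then real_of_int ((n + 1) * (n + 2)) / 2 else 0) =
    (if - 1 \<le> n - 1 then real_of_int ((n - 1 + 1) * (n - 1 + 2)) / 2 else 0) + real_of_int (max 0 (n + 1))"
    by cases (auto simp: field_simps)
  show "(if - 1 \<le> n then real_of_int ((n + 1) * (n + 2)) / 2 else 0) = 0" if "n < 0"
    using that by (cases "n = - 1") auto
qed

text \<open>Up to the factor \<open>(1 - \<beta>)\<^sup>2\<close>, the generating function is \<open>1 / ((1 - z)\<^sup>2 (1 - \<beta> / z))\<close>.\<close>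

definition linear_geometric :: "real \<Rightarrow> int \<Rightarrow> real" where
  "linear_geometric \<beta> n = (if 0 \<le> n then 1 + (1 - \<beta>) * real_of_int n else \<beta> ^ nat (- n))"

lemma power_nat_pred: "n < 0 \<Longrightarrow> \<beta> ^ nat (- (n - 1)) = \<beta> * (\<beta> :: real) ^ nat (- n)"
proof -
  assume "n < 0"
  then have "nat (- (n - 1)) = Suc (nat (- n))" by simp
  then show ?thesis by simp
qed

lemma nondegenerate_linear_geometric:
  assumes \<beta>: "0 < \<beta>" "\<beta> < 1"
  shows "nondegenerate (linear_geometric \<beta>)"
proof -
  \<comment> \<open>\<open>g\<close> has the generating function 1 / (1 - \<beta> z); reflection
    gives 1 / (1 - \<beta> / z), and two divisions by 1 - z give first \<open>s\<close> and then the
    claim. The first factor 1 - \<beta> makes \<open>s\<close> equal to 1 on the nonnegative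
    integers.\<close>
  define g where "g = (\<lambda>n::int. if 0 \<le> n then \<beta> ^ nat n else 0)"
  define s where "s = (\<lambda>n::int. if 0 \<le> n then 1 else \<beta> ^ nat (- n))"
  \<comment> \<open>These sums start at minus infinity; geometric decay to the left takes the place
    of a bounded support.\<close>
  have tail: "(\<lambda>M. 1 ^ M * c (n - int M)) \<longlonglongrightarrow> 0"
    if "\<And>n. n < 0 \<Longrightarrow> c n = \<beta> ^ nat (- n)" for c :: "int \<Rightarrow> real" and n
  proof (rule Lim_transform_eventually)
    show "(\<lambda>M. \<beta> powi (- n) * \<beta> ^ M) \<longlonglongrightarrow> 0"
      using tendsto_mult[OF tendsto_const LIMSEQ_realpow_zero, of \<beta> "\<beta> powi (- n)"] \<beta> by simp
    have "\<forall>\<^sub>F M in sequentially. nat n < M" by (rule eventually_gt_at_top)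
    then show "\<forall>\<^sub>F M in sequentially. \<beta> powi (- n) * \<beta> ^ M = 1 ^ M * c (n - int M)"
    proof eventually_elim
      case (elim M)
      have "\<beta> ^ nat (- (n - int M)) = \<beta> powi (- n + int M)"
        using elim by (simp add: power_int_def)
      also have "\<dots> = \<beta> powi (- n) * \<beta> ^ M"
        by (subst power_int_add) (use \<beta> in auto)
      finally show ?case using elim that[of "n - int M"] by simp
    qed
  qed
  have "nondegenerate g"
  proof (rule nondegenerate_geometric_factor[OF nondegenerate_delta, of \<beta>])
    show "g n = \<beta> * g (n - 1) + (if n = 0 then 1 else 0)" for n
    proof (cases "0 < n")
      case True
      then have "nat n = Suc (nat (n - 1))" by simp
      then show ?thesis using True by (simp add: g_def)
    qed (auto simp: g_def)
    show "(\<lambda>M. \<beta> ^ M * g (n - int M)) \<longlonglongrightarrow> 0" for n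
      by (rule vanishing_left_tail[of 0]) (simp add: g_def)
  qed (use \<beta> in auto)
  then have "nondegenerate (\<lambda>n. (1 - \<beta>) * g (- n))"
    using \<beta> by (intro nondegenerate_scale nondegenerate_reflect) auto
  then have "nondegenerate s"
  proof (rule nondegenerate_geometric_factor[of _ 1])
    fix n :: int
    consider "n < 0" | "n = 0" | "1 \<le> n" by linarith
    then show "s n = 1 * s (n - 1) + (1 - \<beta>) * g (- n)"
      using power_nat_pred[of n \<beta>] by cases (auto simp: s_def g_def algebra_simps)
    show "(\<lambda>M. 1 ^ M * s (m - int M)) \<longlonglongrightarrow> 0" for m
      by (rule tail) (simp add: s_def)
  qed simp
  then have "nondegenerate (\<lambda>n. (1 - \<beta>) * s n)"
    using \<beta> by (intro nondegenerate_scale) auto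
  then show ?thesis
  proof (rule nondegenerate_geometric_factor[of _ 1])
    fix n :: int
    consider "n < 0" | "n = 0" | "1 \<le> n" by linarith
    then show "linear_geometric \<beta> n = 1 * linear_geometric \<beta> (n - 1) + (1 - \<beta>) * s n"
      using power_nat_pred[of n \<beta>] by cases (auto simp: s_def linear_geometric_def algebra_simps)
    show "(\<lambda>M. 1 ^ M * linear_geometric \<beta> (m - int M)) \<longlonglongrightarrow> 0" for m
      by (rule tail) (simp add: linear_geometric_def)
  qed simp
qed

lemma of_int_le_power_2:
  assumes "0 \<le> n"
  shows "real_of_int n + 1 \<le> 2 ^ nat \<bar>n\<bar>"
proof -
  have "real (Suc m) \<le> 2 ^ m" for m
    by (induction m) auto
  from this[of "nat n"] assms show ?thesis by (simp add: add.commute)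
qed

lemma tp_limit_ramp:
  assumes "0 < x"
  shows "tp_limit (\<lambda>n. x * real_of_int (max 0 (n + 1)))"
proof (rule tp_limit_nondegenerate[OF nondegenerate_scale[OF nondegenerate_ramp assms]])
  show "exp_bounded x 2 (\<lambda>n. x * real_of_int (max 0 (n + 1)))"
    unfolding exp_bounded_def
  proof (intro conjI allI mult_left_mono)
    fix n :: int
    show "real_of_int (max 0 (n + 1)) \<le> 2 ^ nat \<bar>n\<bar>"
      using of_int_le_power_2[of n] by (cases "0 \<le> n") auto
  qed (use assms in auto)
qed

lemma tp_limit_triangular:
  assumes "0 < x"
  shows "tp_limit (\<lambda>n. x * (if - 1 \<le> n then real_of_int ((n + 1) * (n + 2)) / 2 else 0))"
proof (rule tp_limit_nondegenerate[OF nondegenerate_scale[OF nondegenerate_triangular assms]])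
  show "exp_bounded x 4 (\<lambda>n. x * (if - 1 \<le> n then real_of_int ((n + 1) * (n + 2)) / 2 else 0))"
    unfolding exp_bounded_def
  proof (intro conjI allI mult_left_mono)
    fix n :: int
    show "(if - 1 \<le> n then real_of_int ((n + 1) * (n + 2)) / 2 else 0) \<le> 4 ^ nat \<bar>n\<bar>"
    proof (cases "0 \<le> n")
      case True
      have "real_of_int ((n + 1) * (n + 2)) / 2 \<le> (real_of_int n + 1) * (real_of_int n + 1)"
        using True by (simp add: field_simps)
      also have "\<dots> \<le> 2 ^ nat \<bar>n\<bar> * 2 ^ nat \<bar>n\<bar>"
        using of_int_le_power_2[OF True] True by (intro mult_mono) auto
      finally show ?thesis using True by (simp flip: power_mult_distrib)
    next
      case False
      then show ?thesis by (cases "n = - 1") auto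
    qed
  qed (use assms in auto)
qed

lemma tp_limit_linear_geometric:
  assumes "0 < x" "0 < \<beta>" "\<beta> < 1"
  shows "tp_limit (\<lambda>n. x * linear_geometric \<beta> n)"
proof (rule tp_limit_nondegenerate[OF nondegenerate_scale[OF nondegenerate_linear_geometric[OF assms(2,3)] assms(1)]])
  show "exp_bounded x 2 (\<lambda>n. x * linear_geometric \<beta> n)"
    unfolding exp_bounded_def
  proof (intro conjI allI mult_left_mono)
    fix n :: int
    show "linear_geometric \<beta> n \<le> 2 ^ nat \<bar>n\<bar>"
    proof (cases "0 \<le> n")
      case True
      have "(1 - \<beta>) * real_of_int n \<le> 1 * real_of_int n"
        using True assms by (intro mult_right_mono) auto
      with of_int_le_power_2[OF True] True show ?thesis by (simp add: linear_geometric_def)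
    next
      case False
      have "\<beta> ^ nat (- n) \<le> 1" using assms by (intro power_le_one) auto
      also have "1 \<le> (2 :: real) ^ nat \<bar>n\<bar>" by simp
      finally show ?thesis using False by (simp add: linear_geometric_def)
    qed
  qed (use assms in auto)
qed

text \<open>All minors of size at least 2 of a geometric sequence vanish, so the smoothing criterion
  does not apply; Gaussian sequences with \<open>q\<close> tending to 1 approximate it
  instead.\<close>

lemma tp_limit_geometric:
  assumes "0 < x" "0 < r"
  shows "tp_limit (\<lambda>n. x * r powi n)"
  unfolding tp_limit_def
proof (intro exI[of _ "\<lambda>m n. x * r powi n * (1 - 1 / real (m + 2)) powi (n * n)"] conjI allI)
  show "tp_polya_frequency_sequence (\<lambda>n. x * r powi n * (1 - 1 / real (m + 2)) powi (n * n))" for m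
    using assms by (intro tp_pfs_gaussian) (auto simp: field_simps)
  fix n
  have "(\<lambda>m. 1 / real (m + 2)) \<longlonglongrightarrow> 0"
    by (rule LIMSEQ_ignore_initial_segment[OF lim_1_over_n])
  then have "(\<lambda>m. x * r powi n * (1 - 1 / real (m + 2)) powi (n * n)) \<longlonglongrightarrow> x * r powi n * (1 - 0) powi (n * n)"
    by (intro tendsto_intros) auto
  then show "(\<lambda>m. x * r powi n * (1 - 1 / real (m + 2)) powi (n * n)) \<longlonglongrightarrow> x * r powi n" by simp
qed

section \<open>Removal of a pole\<close>

text \<open>Eliminating a column turns row differences of \<open>b\<close> into entries of the difference sequence only if the
  rows are consecutive. This weaker form of total nonnegativity still contains nonnegativity and
  log-concavity of the sequence.\<close>

definition row_consecutive_tn :: "(int \<Rightarrow> real) \<Rightarrow> bool" where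
  "row_consecutive_tn b \<longleftrightarrow> (\<forall>n s j. incr n j \<longrightarrow> 0 \<le> toeplitz_minor b n (\<lambda>k. s + int k) j)"

text \<open>Multiplication of the generating function by 1 - z, which cancels a pole at 1.\<close>

definition bdiff :: "(int \<Rightarrow> real) \<Rightarrow> int \<Rightarrow> real" where
  "bdiff b n = b n - b (n - 1)"

abbreviation ratio_to_1 :: "(nat \<Rightarrow> real) \<Rightarrow> bool" where
  "ratio_to_1 f \<equiv> (\<lambda>n. f (Suc n) / f n) \<longlonglongrightarrow> 1"

lemma pfs_imp_row_consecutive_tn: "polya_frequency_sequence b \<Longrightarrow> row_consecutive_tn b"
  by (auto simp: pfs_iff row_consecutive_tn_def strict_mono_on_def)

lemma row_consecutive_tn_nonneg:
  assumes "row_consecutive_tn b"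
  shows "0 \<le> b n"
proof -
  have "0 \<le> toeplitz_minor b (Suc 0) (\<lambda>k. n + int k) (\<lambda>_. 0)"
    using assms incr_1 unfolding row_consecutive_tn_def by blast
  then show ?thesis by (simp add: toeplitz_minor_def fun_det_1)
qed

lemma row_consecutive_tn_log_concave:
  assumes "row_consecutive_tn b" "u < v"
  shows "b u * b (v + 1) \<le> b v * b (u + 1)"
proof -
  define j where "j = (\<lambda>k::nat. if k = 0 then - v else - u)"
  have "incr 2 j" using assms(2) by (auto simp: strict_mono_on_def j_def)
  then have "0 \<le> toeplitz_minor b 2 (\<lambda>k. 0 + int k) j"
    using assms(1) unfolding row_consecutive_tn_def by blast
  then show ?thesis by (simp add: toeplitz_minor_def fun_det_2 j_def add.commute)
qed

text \<open>Division by 0 yields 0, so quotients close to 1 force nonzero denominators.\<close>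

lemma ratio_to_1_eventually_nonzero:
  assumes "ratio_to_1 f"
  shows "\<forall>\<^sub>F n in sequentially. f n \<noteq> 0"
  using order_tendstoD(1)[OF assms, of 0] by (auto elim: eventually_mono)

lemma ratio_to_1_offset:
  assumes "ratio_to_1 f"
  shows "(\<lambda>n. f (n + k) / f n) \<longlonglongrightarrow> 1"
proof (induction k)
  case 0
  show ?case
    by (rule tendsto_eventually) (use ratio_to_1_eventually_nonzero[OF assms] in \<open>auto elim: eventually_mono\<close>)
next
  case (Suc k)
  have "(\<lambda>n. f (Suc (n + k)) / f (n + k)) \<longlonglongrightarrow> 1"
    using LIMSEQ_ignore_initial_segment[OF assms, of k] by simp
  from tendsto_mult[OF this Suc] have "(\<lambda>n. f (Suc (n + k)) / f (n + k) * (f (n + k) / f n)) \<longlonglongrightarrow> 1"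
    by simp
  moreover have "\<forall>\<^sub>F n in sequentially. f (n + k) \<noteq> 0"
    using ratio_to_1_eventually_nonzero[OF assms] by (rule eventually_all_ge_at_top[THEN eventually_mono]) simp
  then have "\<forall>\<^sub>F n in sequentially. f (Suc (n + k)) / f (n + k) * (f (n + k) / f n) = f (n + Suc k) / f n"
    by eventually_elim simp
  ultimately show ?case by (rule Lim_transform_eventually)
qed

text \<open>A first row \<open>s - 1\<close> and a column far to the left are added. After division
  by \<open>b (int N)\<close> the entries of that column tend to 1; row differences then clear it
  below the top, and, the rows being consecutive, the remaining block consists of differences of
  \<open>b\<close>.\<close>

lemma row_consecutive_tn_bdiff:
  assumes b: "row_consecutive_tn b" and ratio: "ratio_to_1 (\<lambda>n. b (int n))"
  shows "row_consecutive_tn (bdiff b)"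
  unfolding row_consecutive_tn_def
proof (intro allI impI)
  fix n s j assume j: "incr n j"
  \<comment> \<open>Column 0 is placed so that its entry in the first row is
    \<open>b (int N)\<close>.\<close>
  define J where "J = (\<lambda>N l. if l = 0 then s - 1 - int N else j (l - 1))"
  define G where "G = (\<lambda>N k l. (if l = 0 then 1 / b (int N) else 1) * b (s - 1 + int k - J N l))"
  define H where "H = (\<lambda>k l. if l = 0 then 1 else b (s - 1 + int k - j (l - 1)))"
  define H' where "H' = (\<lambda>k l. if k = 0 then H 0 l else H k l - H (k - 1) l)"
  have "\<forall>\<^sub>F N in sequentially. nat (s - j 0) < N" by (rule eventually_gt_at_top)
  then have "\<forall>\<^sub>F N in sequentially. 0 \<le> fun_det (Suc n) (G N)"
  proof eventually_elim
    case (elim N)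
    have "incr (Suc n) (J N)"
    proof (rule incrI)
      fix k l assume kl: "k < l" "l < Suc n"
      show "J N k < J N l"
      proof (cases "k = 0")
        case True
        have "l = 1 \<or> 0 < l - 1 \<and> l - 1 < n" using kl by linarith
        then have "j 0 \<le> j (l - 1)" using incrD[OF j, of 0 "l - 1"] by fastforce
        then show ?thesis using True kl elim by (simp add: J_def)
      next
        case False
        then show ?thesis using incrD[OF j, of "k - 1" "l - 1"] kl by (simp add: J_def)
      qed
    qed
    then have "0 \<le> toeplitz_minor b (Suc n) (\<lambda>k. s - 1 + int k) (J N)"
      using b unfolding row_consecutive_tn_def by blast
    then show ?case
      unfolding G_def fun_det_scale_cols toeplitz_minor_def
      using row_consecutive_tn_nonneg[OF b] by (intro mult_nonneg_nonneg prod_nonneg) auto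
  qed
  moreover have "(\<lambda>N. fun_det (Suc n) (G N)) \<longlonglongrightarrow> fun_det (Suc n) H"
  proof (rule fun_det_tendsto)
    fix k l
    show "(\<lambda>N. G N k l) \<longlonglongrightarrow> H k l"
      using ratio_to_1_offset[OF ratio, of k] by (simp add: G_def H_def J_def add.commute)
  qed
  ultimately have "0 \<le> fun_det (Suc n) H"
    by (intro tendsto_lowerbound[of _ _ sequentially]) auto
  also have "fun_det (Suc n) H = fun_det (Suc n) H'"
    by (rule fun_det_row_diff[symmetric, where c = "\<lambda>_. 1"]) (auto simp: H'_def)
  also have "\<dots> = fun_det n (\<lambda>k l. H' (Suc k) (Suc l))"
    by (rule fun_det_first_col) (auto simp: H'_def H_def)
  also have "\<dots> = toeplitz_minor (bdiff b) n (\<lambda>k. s + int k) j"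
    unfolding toeplitz_minor_def by (rule fun_det_cong) (simp add: H'_def H_def bdiff_def algebra_simps)
  finally show "0 \<le> toeplitz_minor (bdiff b) n (\<lambda>k. s + int k) j" .
qed

section \<open>Log-concave sequences and the limits of their ratios\<close>

definition log_concave :: "(nat \<Rightarrow> real) \<Rightarrow> bool" where
  "log_concave f \<longleftrightarrow> (\<forall>n. 0 \<le> f n) \<and> (\<forall>u v. u < v \<longrightarrow> f u * f (Suc v) \<le> f v * f (Suc u))"

lemma log_concave_row_consecutive_tn:
  assumes "row_consecutive_tn b"
  shows "log_concave (\<lambda>n. b (int n))"
  using row_consecutive_tn_nonneg[OF assms] row_consecutive_tn_log_concave[OF assms, of "int _" "int _"]
  by (simp add: log_concave_def add.commute)

text \<open>The inequality holds for all \<open>u < v\<close>, not just for neighbours, so after a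
  positive value a single zero forces only zeros.\<close>

lemma log_concave_eventually_pos:
  assumes f: "log_concave f" and "\<not> (\<exists>N. \<forall>n\<ge>N. f n = 0)"
  shows "\<exists>N. \<forall>n\<ge>N. 0 < f n"
proof -
  have nn: "0 \<le> f n" for n using f by (simp add: log_concave_def)
  have inf: "\<exists>n\<ge>N. 0 < f n" for N using assms(2) nn by (metis order.order_iff_strict)
  then obtain u where u: "0 < f u" by blast
  have "0 < f v" if "u < v" for v
  proof -
    obtain n where "v \<le> n" "0 < f n" using inf by blast
    then show ?thesis
    proof (induction v rule: inc_induct)
      case (step m)
      have "0 < f u * f (Suc m)" using u step.IH step.prems by simp
      also have "\<dots> \<le> f m * f (Suc u)"
        using f that step.hyps(1) by (simp add: log_concave_def)
      finally show ?case using nn[of m] by (cases "f m = 0") auto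
    qed
  qed
  then show ?thesis by (intro exI[of _ "Suc u"]) auto
qed

lemma log_concave_ratio_antimono:
  assumes f: "log_concave f" and pos: "\<And>n. N \<le> n \<Longrightarrow> 0 < f n" and "N \<le> m" "m \<le> n"
  shows "f (Suc n) / f n \<le> f (Suc m) / f m"
proof (cases "m = n")
  case False
  then have "f m * f (Suc n) \<le> f n * f (Suc m)" using f assms(4) by (simp add: log_concave_def)
  then show ?thesis using pos[of m] pos[of n] assms(3,4) by (simp add: field_simps)
qed simp

lemma log_concave_ratio_convergent:
  assumes f: "log_concave f" and pos: "\<And>n. N \<le> n \<Longrightarrow> 0 < f n"
  obtains L where "(\<lambda>n. f (Suc n) / f n) \<longlonglongrightarrow> L" "0 \<le> L" "\<And>n. N \<le> n \<Longrightarrow> L * f n \<le> f (Suc n)"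
proof -
  define r where "r = (\<lambda>n. f (Suc (n + N)) / f (n + N))"
  have "decseq r"
    unfolding decseq_def r_def using log_concave_ratio_antimono[OF f pos] by simp
  moreover have r0: "0 \<le> r n" for n
    using pos[of "n + N"] pos[of "Suc (n + N)"] by (simp add: r_def)
  ultimately obtain L where L: "r \<longlonglongrightarrow> L" "\<And>n. L \<le> r n"
    using decseq_convergent[of r 0] by blast
  show ?thesis
  proof (rule that[of L])
    show "(\<lambda>n. f (Suc n) / f n) \<longlonglongrightarrow> L"
      using L(1) unfolding r_def by (rule LIMSEQ_offset)
    show "0 \<le> L" by (rule LIMSEQ_le_const[OF L(1)]) (use r0 in auto)
    show "L * f n \<le> f (Suc n)" if "N \<le> n" for n
      using L(2)[of "n - N"] pos[OF that] that by (simp add: r_def field_simps)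
  qed
qed

text \<open>For \<open>L > 1\<close> the quotient \<open>f n / g n\<close> would eventually grow at
  least geometrically, against \<open>f n \<le> g n\<close>.\<close>

lemma ratio_limit_le_1_if_dominated:
  assumes f: "\<And>n. N \<le> n \<Longrightarrow> 0 < f n" and le: "\<And>n. f n \<le> g n"
    and fL: "(\<lambda>n. f (Suc n) / f n) \<longlonglongrightarrow> (L::real)" and g1: "ratio_to_1 g"
  shows "L \<le> 1"
proof (rule ccontr)
  assume "\<not> L \<le> 1"
  then obtain q where q: "1 < q" "q < L" using dense[of 1 L] by auto
  have "(\<lambda>n. (f (Suc n) / f n) / (g (Suc n) / g n)) \<longlonglongrightarrow> L / 1"
    by (intro tendsto_divide fL g1) simp
  then have "\<forall>\<^sub>F n in sequentially. q < (f (Suc n) / f n) / (g (Suc n) / g n)"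
    using q by (intro order_tendstoD(1)) auto
  then obtain M where M: "\<And>n. M \<le> n \<Longrightarrow> q < (f (Suc n) / f n) / (g (Suc n) / g n)"
    by (auto simp: eventually_sequentially)
  define s where "s = max M N"
  have gpos: "0 < g n" if "N \<le> n" for n using f[OF that] le[of n] by simp
  have "q ^ k * (f s / g s) \<le> f (s + k) / g (s + k)" for k
  proof (induction k)
    case (Suc k)
    have "q * (f (s + k) / g (s + k)) \<le> f (s + Suc k) / g (s + Suc k)"
      using M[of "s + k"] f[of "s + k"] gpos[of "s + k"] gpos[of "s + Suc k"]
      by (simp add: s_def field_simps less_imp_le)
    moreover have "q * (q ^ k * (f s / g s)) \<le> q * (f (s + k) / g (s + k))"
      using Suc q by (intro mult_left_mono) auto
    ultimately show ?case by simp
  qed simp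
  also have "f (s + k) / g (s + k) \<le> 1" for k
    using le[of "s + k"] gpos[of "s + k"] by (simp add: s_def)
  finally have bound: "q ^ k * (f s / g s) \<le> 1" for k .
  define t where "t = f s / g s"
  have t: "0 < t" using f gpos by (simp add: t_def s_def)
  obtain k where "1 / t < q ^ k" using real_arch_pow[OF q(1)] by blast
  then have "1 < q ^ k * t" using t by (simp add: field_simps)
  with bound[of k] show False by (simp add: t_def)
qed

lemma eventually_le_geometric:
  assumes f: "\<And>n. N \<le> n \<Longrightarrow> 0 < f n" and L: "(\<lambda>n. f (Suc n) / f n) \<longlonglongrightarrow> (L::real)" "0 \<le> L" "L < 1"
  shows "\<exists>C q M. 0 < q \<and> q < 1 \<and> (\<forall>n\<ge>M. f n \<le> C * q ^ n)"
proof -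
  obtain q where q: "L < q" "q < 1" using dense[OF L(3)] by auto
  then have q0: "0 < q" using L(2) by simp
  from order_tendstoD(2)[OF L(1) q(1)] obtain M where M: "\<And>n. M \<le> n \<Longrightarrow> f (Suc n) / f n < q"
    by (auto simp: eventually_sequentially)
  define s where "s = max M N"
  have "f (s + k) \<le> f s / q ^ s * q ^ (s + k)" for k
  proof (induction k)
    case 0
    then show ?case using q0 by simp
  next
    case (Suc k)
    have "f (Suc (s + k)) \<le> q * f (s + k)"
      using M[of "s + k"] f[of "s + k"] by (simp add: s_def field_simps less_imp_le)
    also have "\<dots> \<le> q * (f s / q ^ s * q ^ (s + k))"
      using Suc q0 by (intro mult_left_mono) auto
    finally show ?case by (simp add: mult_ac)
  qed
  then have "f n \<le> f s / q ^ s * q ^ n" if "s \<le> n" for n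
    using le_Suc_ex[OF that] by auto
  then show ?thesis using q(2) q0 by blast
qed

text \<open>Meant for successive differences: either one more pole at 1 can be removed, or there is
  exponential decay. Unless \<open>f\<close> is eventually zero, its ratios have a limit, and
  domination by \<open>g\<close> keeps that limit at most 1.\<close>

lemma log_concave_dichotomy:
  assumes f: "log_concave f" and "\<And>n. f n \<le> g n" "ratio_to_1 g"
  shows "ratio_to_1 f \<or> (\<exists>C q M. 0 < q \<and> q < 1 \<and> (\<forall>n\<ge>M. f n \<le> C * q ^ n))"
proof (cases "\<exists>N. \<forall>n\<ge>N. f n = 0")
  case True
  then obtain N where "\<And>n. N \<le> n \<Longrightarrow> f n = 0" by blast
  then have "\<forall>n\<ge>N. f n \<le> 0 * (1 / 2) ^ n" by simp
  then show ?thesis by (intro disjI2 exI[of _ "0::real"] exI[of _ "1/2::real"]) auto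
next
  case False
  from log_concave_eventually_pos[OF f this] obtain N where N: "\<And>n. N \<le> n \<Longrightarrow> 0 < f n" by blast
  from log_concave_ratio_convergent[OF f N] obtain L
    where L: "(\<lambda>n. f (Suc n) / f n) \<longlonglongrightarrow> L" "0 \<le> L" by blast
  have "L \<le> 1" using N assms(2) L(1) assms(3) by (rule ratio_limit_le_1_if_dominated)
  then consider "L = 1" | "L < 1" by linarith
  then show ?thesis
  proof cases
    case 1
    then show ?thesis using L by simp
  next
    case 2
    then show ?thesis using eventually_le_geometric[OF N L] by blast
  qed
qed

lemma summable_if_le_geometric:
  fixes f :: "nat \<Rightarrow> real"
  assumes "\<And>n. 0 \<le> f n" "0 < q" "q < 1" "\<forall>n\<ge>M. f n \<le> C * q ^ n"
  shows "summable f"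
proof (rule summable_comparison_test_ev)
  show "\<forall>\<^sub>F n in sequentially. norm (f n) \<le> C * q ^ n"
    using assms by (auto simp: eventually_sequentially)
  show "summable (\<lambda>n. C * q ^ n)"
    using assms by (intro summable_mult summable_geometric) auto
qed

lemma ratio_to_1_perturbation:
  fixes p E :: "nat \<Rightarrow> real"
  assumes p: "filterlim p at_top sequentially" "ratio_to_1 p" and E: "E \<longlonglongrightarrow> l"
  shows "ratio_to_1 (\<lambda>n. p n + E n)"
proof -
  have "(\<lambda>n. 1 + E n / p n) \<longlonglongrightarrow> 1 + 0"
    by (intro tendsto_intros tendsto_divide_0[OF E] filterlim_at_top_imp_at_infinity p)
  then have h: "(\<lambda>n. 1 + E n / p n) \<longlonglongrightarrow> 1" by simp
  have "(\<lambda>n. (1 + E (Suc n) / p (Suc n)) * (p (Suc n) / p n) / (1 + E n / p n)) \<longlonglongrightarrow> 1 * 1 / 1"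
    by (intro tendsto_intros h p LIMSEQ_Suc[OF h]) auto
  moreover have ev: "\<forall>\<^sub>F n in sequentially. 0 < p n"
    using p(1) by (auto simp: filterlim_at_top_dense)
  have "\<forall>\<^sub>F n in sequentially. 0 < p (Suc n)"
    using ev by (rule eventually_all_ge_at_top[THEN eventually_mono]) simp
  with ev have "\<forall>\<^sub>F n in sequentially. (1 + E (Suc n) / p (Suc n)) * (p (Suc n) / p n) / (1 + E n / p n)
     = (p (Suc n) + E (Suc n)) / (p n + E n)"
  proof eventually_elim
    case (elim n)
    have "1 + E n / p n = (p n + E n) / p n" "1 + E (Suc n) / p (Suc n) = (p (Suc n) + E (Suc n)) / p (Suc n)"
      using elim by (auto simp: add_divide_distrib)
    then show ?case using elim by simp
  qed
  ultimately show ?thesis by (simp add: Lim_transform_eventually)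
qed

text \<open>Applied to the negated function, it also bounds increments from above.\<close>

lemma increments_ge:
  fixes g :: "int \<Rightarrow> real"
  assumes "\<And>m. s \<le> m \<Longrightarrow> m < s + int k \<Longrightarrow> d \<le> g (m + 1) - g m"
  shows "real k * d \<le> g (s + int k) - g s"
  using assms
proof (induction k)
  case (Suc k)
  have "real k * d \<le> g (s + int k) - g s" by (rule Suc.IH) (use Suc.prems in simp)
  moreover have "d \<le> g (s + int k + 1) - g (s + int k)" by (rule Suc.prems) auto
  ultimately show ?case by (simp add: algebra_simps)
qed simp

section \<open>Preservers of Polya frequency sequences\<close>

lemma preserver_const:
  assumes nn: "\<And>x. 0 \<le> x \<Longrightarrow> 0 \<le> F x"
    and pres: "\<And>a. tp_limit a \<Longrightarrow> polya_frequency_sequence (\<lambda>n. F (a n))"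
    and F0: "0 < F 0" and x: "0 \<le> x"
  shows "F x = F 0"
proof (cases "x = 0")
  case False
  then have "0 < x" using x by simp
  then have "tp_limit (\<lambda>n. x * (if n = 0 then 1 else 0))"
    by (intro tp_limit_nondegenerate[of _ x 1] nondegenerate_scale nondegenerate_delta)
      (auto simp: exp_bounded_def)
  then have "row_consecutive_tn (\<lambda>n. F (x * (if n = 0 then 1 else 0)))"
    by (intro pfs_imp_row_consecutive_tn pres)
  note lc = row_consecutive_tn_log_concave[OF this]
  \<comment> \<open>These are 2 by 2 minors around the exceptional entry at index 0. They give F 0
    \<le> F x and, after division by F 0 > 0, F x \<le> F 0.\<close>
  have "F 0 * F 0 \<le> F x * F x" "F 0 * F x \<le> F 0 * F 0"
    using lc[of "-1" 0] lc[of "-2" "-1"] by auto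
  moreover from this have "F 0 \<le> F x"
    using nn[OF x] by (intro power2_le_imp_le[of "F 0"]) (auto simp: power2_eq_square)
  ultimately show ?thesis using F0 by simp
qed simp

locale nontrivial_preserver =
  fixes F :: "real \<Rightarrow> real" and x0 :: real
  assumes nonneg: "\<And>x. 0 \<le> x \<Longrightarrow> 0 \<le> F x"
    and pres: "\<And>a. tp_limit a \<Longrightarrow> polya_frequency_sequence (\<lambda>n. F (a n))"
    and F_0: "F 0 = 0"
    and x0: "0 < x0" "0 < F x0"
begin

text \<open>A 2 by 2 minor of the image of x, y, x gives monotonicity across a factor of at least 2.
  The tridiagonal 3 by 3 minor gives growth by a factor sqrt 2 under doubling wherever
  \<open>F\<close> is positive, which makes \<open>F\<close> unbounded.\<close>

lemma three_terms:
  assumes "0 < x" "2 * x \<le> y"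
  shows "F x \<le> F y" "2 * (F x)\<^sup>2 * F y \<le> (F y) ^ 3"
proof -
  define c where "c = (\<lambda>n::int. F (if n = 0 \<or> n = 2 then x else if n = 1 then y else 0))"
  have c: "row_consecutive_tn c"
    unfolding c_def by (intro pfs_imp_row_consecutive_tn pres tp_limit_three_terms assms)
  from row_consecutive_tn_log_concave[OF c, of 0 1] have "(F x)\<^sup>2 \<le> (F y)\<^sup>2"
    by (simp add: c_def power2_eq_square)
  then show "F x \<le> F y"
    by (rule power2_le_imp_le) (use nonneg[of y] assms in simp)
  have "incr 3 int" by (auto simp: strict_mono_on_def)
  then have "0 \<le> toeplitz_minor c 3 (\<lambda>k. 1 + int k) int"
    using c unfolding row_consecutive_tn_def by blast
  then show "2 * (F x)\<^sup>2 * F y \<le> (F y) ^ 3"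
    by (simp add: toeplitz_minor_def fun_det_3 c_def F_0 power2_eq_square power3_eq_cube algebra_simps)
qed

lemma F_pos_ge: "2 * x0 \<le> y \<Longrightarrow> 0 < F y"
  using three_terms(1)[OF x0(1), of y] x0(2) by simp

lemma doubling_growth:
  assumes "2 * x0 \<le> y"
  shows "2 ^ k * (F y)\<^sup>2 \<le> (F (2 ^ k * y))\<^sup>2"
proof (induction k)
  case (Suc k)
  have "2 * x0 \<le> 2 ^ k * y"
    using mult_mono[of 1 "2 ^ k" "2 * x0" y] assms x0 by simp
  then have pos: "0 < F (2 ^ k * y)" "0 < 2 ^ k * y" "0 < F (2 * (2 ^ k * y))"
    using F_pos_ge x0 by auto
  from three_terms(2)[OF pos(2), of "2 * (2 ^ k * y)"] pos(3)
  have "2 * (F (2 ^ k * y))\<^sup>2 \<le> (F (2 * (2 ^ k * y)))\<^sup>2"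
    by (simp add: power3_eq_cube power2_eq_square)
  with Suc show ?case by (simp add: mult.assoc)
qed simp

lemma geometric_log_concave:
  assumes "0 < x" "0 < r"
  shows "log_concave (\<lambda>n. F (x * r ^ n))"
  using log_concave_row_consecutive_tn[OF pfs_imp_row_consecutive_tn[OF pres[OF tp_limit_geometric[OF assms]]]]
  by simp

section \<open>Values of \<open>F\<close> on the multiples of a fixed number\<close>

definition ramp :: "real \<Rightarrow> int \<Rightarrow> real" where
  "ramp \<eta> z = F (\<eta> * real_of_int (max 0 z))"

lemma ramp_row_consecutive_tn:
  assumes "0 < \<eta>"
  shows "row_consecutive_tn (ramp \<eta>)"
proof -
  have "polya_frequency_sequence (\<lambda>n. F (\<eta> * real_of_int (max 0 (n + - 1 + 1))))"
    by (rule pfs_shift[of _ "-1"]) (rule pres[OF tp_limit_ramp[OF assms]])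
  then show ?thesis
    unfolding ramp_def[abs_def] by (intro pfs_imp_row_consecutive_tn) simp
qed

lemma ramp_nonpos [simp]: "z \<le> 0 \<Longrightarrow> ramp \<eta> z = 0"
  by (simp add: ramp_def F_0)

lemma ramp_nonneg: "0 < \<eta> \<Longrightarrow> 0 \<le> ramp \<eta> z"
  unfolding ramp_def by (intro nonneg mult_nonneg_nonneg) auto

lemma ramp_of_nat: "ramp \<eta> (int n) = F (\<eta> * real n)"
  by (simp add: ramp_def)

context
  fixes \<eta> :: real
  assumes \<eta>: "0 < \<eta>"
begin

lemma ramp_pos: obtains N where "0 < N" "\<And>n. N \<le> n \<Longrightarrow> 0 < ramp \<eta> (int n)" "2 * x0 \<le> \<eta> * real N"
proof -
  obtain N where N: "2 * x0 / \<eta> < real N" using reals_Archimedean2 by blast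
  show ?thesis
  proof (rule that)
    have *: "2 * x0 \<le> \<eta> * real n" if "N \<le> n" for n
    proof -
      have "2 * x0 / \<eta> < real n" using N that by simp
      then show ?thesis using \<eta> by (simp add: field_simps)
    qed
    then show "0 < ramp \<eta> (int n)" if "N \<le> n" for n
      unfolding ramp_of_nat using that by (intro F_pos_ge)
    show "2 * x0 \<le> \<eta> * real N" using *[of N] by simp
    show "0 < N"
    proof (rule ccontr)
      assume "\<not> 0 < N"
      then show False using *[of N] x0 by simp
    qed
  qed
qed

lemma ramp_not_Bseq: "\<not> Bseq (\<lambda>n. ramp \<eta> (int n))"
proof
  assume "Bseq (\<lambda>n. ramp \<eta> (int n))"
  then obtain K where K: "0 < K" "\<And>n. norm (ramp \<eta> (int n)) \<le> K" by (auto simp: Bseq_def)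
  obtain N where N: "0 < N" "\<And>n. N \<le> n \<Longrightarrow> 0 < ramp \<eta> (int n)" "2 * x0 \<le> \<eta> * real N" using ramp_pos by blast
  define y where "y = \<eta> * real N"
  have Fy: "0 < (F y)\<^sup>2" using N(2)[of N] by (simp add: ramp_of_nat y_def)
  obtain k where k: "K\<^sup>2 / (F y)\<^sup>2 < 2 ^ k" using real_arch_pow[of 2] by auto
  have "2 ^ k * (F y)\<^sup>2 \<le> (F (2 ^ k * y))\<^sup>2" using N(3) by (intro doubling_growth) (simp add: y_def)
  also have "2 ^ k * y = \<eta> * real (2 ^ k * N)" by (simp add: y_def)
  also have "(F \<dots>)\<^sup>2 \<le> K\<^sup>2"
    using K(2)[of "2 ^ k * N"] unfolding ramp_of_nat by (simp add: abs_le_square_iff[symmetric] power2_le_iff_abs_le)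
  finally show False using k Fy by (simp add: field_simps)
qed

text \<open>Geometric sequences have log-concave images, so the ratios of \<open>F\<close> along the
  powers of 2 decrease.\<close>

lemma ramp_doubling_bound:
  obtains K k0 where "0 < K" "\<And>k. k0 \<le> k \<Longrightarrow> 0 < ramp \<eta> (2 ^ k)"
    "\<And>k. k0 \<le> k \<Longrightarrow> ramp \<eta> (2 ^ Suc k) \<le> K * ramp \<eta> (2 ^ k)"
proof -
  define g where "g = (\<lambda>k. ramp \<eta> (2 ^ k))"
  have g_eq: "g k = F (\<eta> * 2 ^ k)" for k
    using ramp_of_nat[of \<eta> "2 ^ k"] by (simp add: g_def)
  have lc: "log_concave g"
    unfolding g_eq[abs_def] by (rule geometric_log_concave[OF \<eta>]) simp
  obtain N where N: "\<And>n. N \<le> n \<Longrightarrow> 0 < ramp \<eta> (int n)" using ramp_pos by blast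
  have pos: "0 < g k" if "N \<le> k" for k
  proof -
    have "N \<le> 2 ^ k" using that less_exp[of k] by linarith
    then show ?thesis using N[of "2 ^ k"] by (simp add: g_def)
  qed
  show ?thesis
  proof (rule that[of "g (Suc N) / g N" N])
    show "0 < g (Suc N) / g N" using pos by simp
    fix k assume k: "N \<le> k"
    show "0 < ramp \<eta> (2 ^ k)" using pos[OF k] by (simp add: g_def)
    have "g (Suc k) / g k \<le> g (Suc N) / g N"
      by (rule log_concave_ratio_antimono[OF lc pos]) (use k in auto)
    then have "g (Suc k) \<le> g (Suc N) / g N * g k" using pos[OF k] by (simp add: divide_le_eq)
    then show "ramp \<eta> (2 ^ Suc k) \<le> g (Suc N) / g N * ramp \<eta> (2 ^ k)" by (simp add: g_def)
  qed
qed

text \<open>Log-concavity gives a limit ratio \<open>L\<close>. If \<open>L < 1\<close>, the values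
  would be summable, hence bounded; if \<open>L > 1\<close>, the step from 2^k to 2^(k+1) would
  multiply them by at least L^(2^k), against the doubling bound.\<close>

lemma ramp_ratio: "ratio_to_1 (\<lambda>n. ramp \<eta> (int n))"
proof -
  let ?b = "\<lambda>n. ramp \<eta> (int n)"
  have lc: "log_concave ?b" by (rule log_concave_row_consecutive_tn[OF ramp_row_consecutive_tn[OF \<eta>]])
  obtain N where N: "0 < N" "\<And>n. N \<le> n \<Longrightarrow> 0 < ?b n" using ramp_pos by blast
  obtain L where L: "(\<lambda>n. ?b (Suc n) / ?b n) \<longlonglongrightarrow> L" "0 \<le> L" "\<And>n. N \<le> n \<Longrightarrow> L * ?b n \<le> ?b (Suc n)"
    using log_concave_ratio_convergent[of ?b N, OF lc N(2)] by blast
  have "\<not> L < 1"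
  proof
    assume "L < 1"
    from eventually_le_geometric[of N ?b, OF N(2) L(1,2) this] obtain C q M
      where "0 < q" "q < 1" "\<forall>n\<ge>M. ?b n \<le> C * q ^ n" by blast
    then have "summable ?b"
      using ramp_nonneg[OF \<eta>] by (intro summable_if_le_geometric[of ?b q M C]) auto
    then show False
      using ramp_not_Bseq by (metis summable_LIMSEQ_zero convergent_imp_Bseq convergentI)
  qed
  moreover have "\<not> 1 < L"
  proof
    assume L1: "1 < L"
    obtain K k0 where K: "\<And>k. k0 \<le> k \<Longrightarrow> 0 < ramp \<eta> (2 ^ k)"
      "\<And>k. k0 \<le> k \<Longrightarrow> ramp \<eta> (2 ^ Suc k) \<le> K * ramp \<eta> (2 ^ k)"
      using ramp_doubling_bound by metis
    have growth: "L ^ m * ?b n \<le> ?b (n + m)" if "N \<le> n" for n m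
    proof (induction m)
      case (Suc m)
      have "L * (L ^ m * ?b n) \<le> L * ?b (n + m)" using Suc L(2) by (rule mult_left_mono)
      also have "\<dots> \<le> ?b (Suc (n + m))" using L(3)[of "n + m"] that by simp
      finally show ?case by simp
    qed simp
    obtain k1 where k1: "K < L ^ k1" using real_arch_pow[OF L1] by blast
    define k where "k = max k1 (max k0 N)"
    have "k < 2 ^ k" by (rule less_exp)
    moreover have k: "k1 \<le> k" "k0 \<le> k" "N \<le> k" by (auto simp: k_def)
    ultimately have k: "k0 \<le> k" "N \<le> 2 ^ k" "k1 \<le> 2 ^ k" by linarith+
    have "L ^ (2 ^ k) * ramp \<eta> (2 ^ k) \<le> ramp \<eta> (2 ^ Suc k)"
      using growth[OF k(2), of "2 ^ k"] by simp
    also have "\<dots> \<le> K * ramp \<eta> (2 ^ k)" by (rule K(2)[OF k(1)])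
    finally have "L ^ (2 ^ k) \<le> K" using K(1)[OF k(1)] by simp
    moreover have "L ^ k1 \<le> L ^ (2 ^ k)" using k(3) L1 by (intro power_increasing) auto
    ultimately show False using k1 by simp
  qed
  ultimately show ?thesis using L(1) by (cases "L = 1") auto
qed

lemma ramp_bdiff_row_consecutive_tn: "row_consecutive_tn (bdiff (ramp \<eta>))"
  by (rule row_consecutive_tn_bdiff[OF ramp_row_consecutive_tn[OF \<eta>] ramp_ratio])

lemma sum_bdiff_ramp: "(\<Sum>k\<le>n. bdiff (ramp \<eta>) (int k)) = ramp \<eta> (int n)"
  by (induction n) (auto simp: bdiff_def)

text \<open>The differences are dominated by the ramp; exponential decay would make their partial
  sums, which are the ramp itself, converge.\<close>

lemma bdiff_ramp_ratio: "ratio_to_1 (\<lambda>n. bdiff (ramp \<eta>) (int n))"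
proof -
  let ?u = "\<lambda>n. bdiff (ramp \<eta>) (int n)"
  have le: "?u n \<le> ramp \<eta> (int n)" for n using ramp_nonneg[OF \<eta>] by (simp add: bdiff_def)
  have "ratio_to_1 ?u \<or> (\<exists>C q M. 0 < q \<and> q < 1 \<and> (\<forall>n\<ge>M. ?u n \<le> C * q ^ n))"
    by (rule log_concave_dichotomy[OF log_concave_row_consecutive_tn[OF ramp_bdiff_row_consecutive_tn] le ramp_ratio])
  moreover have False if "0 < q" "q < 1" "\<forall>n\<ge>M. ?u n \<le> C * q ^ n" for C q M
  proof -
    have "summable ?u"
      using row_consecutive_tn_nonneg[OF ramp_bdiff_row_consecutive_tn] that
      by (intro summable_if_le_geometric[of ?u q M C])
    then have "(\<lambda>n. \<Sum>k\<le>n. ?u k) \<longlonglongrightarrow> suminf ?u" by (rule summable_LIMSEQ')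
    then show False
      unfolding sum_bdiff_ramp using ramp_not_Bseq convergent_imp_Bseq convergentI by blast
  qed
  ultimately show ?thesis by blast
qed

lemma ramp_bdiff2_row_consecutive_tn: "row_consecutive_tn (bdiff (bdiff (ramp \<eta>)))"
  by (rule row_consecutive_tn_bdiff[OF ramp_bdiff_row_consecutive_tn bdiff_ramp_ratio])

lemma bdiff_ramp_nonneg: "0 \<le> bdiff (ramp \<eta>) z"
  by (rule row_consecutive_tn_nonneg[OF ramp_bdiff_row_consecutive_tn])

lemma bdiff2_ramp_nonneg: "0 \<le> bdiff (bdiff (ramp \<eta>)) z"
  by (rule row_consecutive_tn_nonneg[OF ramp_bdiff2_row_consecutive_tn])

lemma bdiff_ramp_mono:
  assumes "y \<le> z"
  shows "bdiff (ramp \<eta>) y \<le> bdiff (ramp \<eta>) z"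
  using assms
proof (induction z rule: int_ge_induct)
  case (step z)
  then show ?case using bdiff2_ramp_nonneg[of "z + 1"] by (simp add: bdiff_def[of "bdiff _"])
qed simp

lemma ramp_mono: "y \<le> z \<Longrightarrow> ramp \<eta> y \<le> ramp \<eta> z"
proof (induction z rule: int_ge_induct)
  case (step z)
  then show ?case using bdiff_ramp_nonneg[of "z + 1"] by (simp add: bdiff_def)
qed simp

end

end

section \<open>Third differences\<close>

context nontrivial_preserver begin

text \<open>The inequality says \<open>c 1 - 3 * c 0 + 3 * c (-1) - c (-2) \<ge> 0\<close> for the image \<open>c\<close> of the linear-geometric
  sequence with \<open>\<beta> = 1 - 1 / m\<close>, scaled by \<open>\<eta> m\<close>; it fails for the identity.\<close>

lemma third_difference_test:
  assumes \<eta>: "0 < \<eta>" and ratio: "ratio_to_1 (\<lambda>n. bdiff (bdiff (ramp \<eta>)) (int n))" and m: "2 \<le> m"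
  shows "F (\<eta> / real m * (real m - 1)\<^sup>2) \<le>
    ramp \<eta> (int m + 1) - 3 * ramp \<eta> (int m) + 3 * ramp \<eta> (int m - 1)"
proof -
  \<comment> \<open>With this \<beta> the scaled sequence equals \<eta> (m + n) for n \<ge> -1; at n
    = -2 it leaves the multiples of \<eta> and takes the value \<eta> (m - 1)^2 / m.\<close>
  define \<beta> where "\<beta> = 1 - 1 / real m"
  have \<beta>: "0 < \<beta>" "\<beta> < 1" using m by (auto simp: \<beta>_def)
  define c where "c = (\<lambda>n. F (\<eta> * real m * linear_geometric \<beta> n))"
  have c: "row_consecutive_tn c"
    unfolding c_def using \<eta> m by (intro pfs_imp_row_consecutive_tn pres tp_limit_linear_geometric \<beta>) auto
  have c_eq: "c n = ramp \<eta> (int m + n)" if "- 1 \<le> n" for n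
  proof (cases "0 \<le> n")
    case True
    have "\<eta> * real m * linear_geometric \<beta> n = \<eta> * real_of_int (max 0 (int m + n))"
      using m True by (simp add: linear_geometric_def \<beta>_def field_simps)
    then show ?thesis by (simp only: c_def ramp_def)
  next
    case False
    then have n: "n = - 1" using that by simp
    have "\<eta> * real m * linear_geometric \<beta> n = \<eta> * real_of_int (max 0 (int m + n))"
      using m unfolding n by (simp add: linear_geometric_def \<beta>_def field_simps)
    then show ?thesis by (simp only: c_def ramp_def)
  qed
  have c_1: "bdiff c n = bdiff (ramp \<eta>) (int m + n)" if "0 \<le> n" for n
    using that by (simp add: bdiff_def c_eq algebra_simps)
  have c_2: "bdiff (bdiff c) n = bdiff (bdiff (ramp \<eta>)) (int m + n)" if "1 \<le> n" for n
    using that by (simp add: bdiff_def[of "bdiff _"] c_1 algebra_simps)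
  have "ratio_to_1 (\<lambda>n. c (int n))"
    using LIMSEQ_ignore_initial_segment[OF ramp_ratio[OF \<eta>], of m] by (simp add: c_eq algebra_simps)
  note d1 = row_consecutive_tn_bdiff[OF c this]
  have "ratio_to_1 (\<lambda>n. bdiff c (int n))"
    using LIMSEQ_ignore_initial_segment[OF bdiff_ramp_ratio[OF \<eta>], of m] by (simp add: c_1 algebra_simps)
  note d2 = row_consecutive_tn_bdiff[OF d1 this]
  \<comment> \<open>Index 0 is left out, since the second difference there already involves
    \<open>c (- 2)\<close>.\<close>
  have c_2': "bdiff (bdiff c) (int (Suc n)) = bdiff (bdiff (ramp \<eta>)) (int (n + Suc m))" for n
    using c_2[of "int (Suc n)"] by (simp add: algebra_simps)
  have "ratio_to_1 (\<lambda>n. bdiff (bdiff c) (int (Suc n)))"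
    unfolding c_2' using LIMSEQ_ignore_initial_segment[OF ratio, of "Suc m"] by simp
  then have "ratio_to_1 (\<lambda>n. bdiff (bdiff c) (int n))" by (rule LIMSEQ_imp_Suc)
  note d3 = row_consecutive_tn_bdiff[OF d2 this]
  have "0 \<le> bdiff (bdiff (bdiff c)) 1" by (rule row_consecutive_tn_nonneg[OF d3])
  then have "c (- 2) \<le> c 1 - 3 * c 0 + 3 * c (- 1)" by (simp add: bdiff_def)
  also have "\<dots> = ramp \<eta> (int m + 1) - 3 * ramp \<eta> (int m) + 3 * ramp \<eta> (int m - 1)"
    by (simp add: c_eq)
  finally have "c (- 2) \<le> \<dots>" .
  moreover have "\<eta> * real m * linear_geometric \<beta> (- 2) = \<eta> / real m * (real m - 1)\<^sup>2"
    using m by (simp add: linear_geometric_def \<beta>_def field_simps power2_eq_square)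
  ultimately show ?thesis by (simp only: c_def)
qed

text \<open>Because (m - 1)^2 = m (m - 2) + 1, the test point lies one step of the finer lattice, of
  mesh \<eta> / m, above \<eta> (m - 2). Convexity on the finer lattice makes this fine increment at
  least 1 / m of the preceding coarse one.\<close>

lemma bdiff2_ramp_increment:
  assumes \<eta>: "0 < \<eta>" and ratio: "ratio_to_1 (\<lambda>n. bdiff (bdiff (ramp \<eta>)) (int n))" and m: "3 \<le> m"
  shows "bdiff (ramp \<eta>) (int m - 2) / real m \<le> bdiff (bdiff (ramp \<eta>)) (int m + 1) - bdiff (bdiff (ramp \<eta>)) (int m)"
proof -
  define \<eta>' where "\<eta>' = \<eta> / real m"
  have \<eta>': "0 < \<eta>'" using \<eta> m by (simp add: \<eta>'_def)
  define M where "M = int m * (int m - 2)"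
  define D where "D = bdiff (ramp \<eta>') (M + 1)"
  have refine: "ramp \<eta>' (int m * k) = ramp \<eta> k" for k
  proof (cases "0 \<le> k")
    case True
    then have "max 0 (int m * k) = int m * k" "max 0 k = k" by auto
    then show ?thesis using m by (simp add: ramp_def \<eta>'_def)
  next
    case False
    then have "int m * k \<le> 0" by (simp add: mult_nonneg_nonpos)
    then show ?thesis using False by simp
  qed
  \<comment> \<open>The coarse increment consists of \<open>m\<close> fine ones, each at most
    \<open>D\<close>.\<close>
  have "real m * - D \<le> - ramp \<eta>' (M - int m + int m) - - ramp \<eta>' (M - int m)"
  proof (rule increments_ge[where g = "\<lambda>z. - ramp \<eta>' z"])
    fix z assume "M - int m \<le> z" "z < M - int m + int m"
    then have "bdiff (ramp \<eta>') (z + 1) \<le> D" unfolding D_def by (intro bdiff_ramp_mono[OF \<eta>']) simp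
    then show "- D \<le> - ramp \<eta>' (z + 1) - - ramp \<eta>' z" by (simp add: bdiff_def)
  qed
  moreover have "M - int m = int m * (int m - 3)" by (simp add: M_def algebra_simps)
  ultimately have "ramp \<eta> (int m - 2) - ramp \<eta> (int m - 3) \<le> real m * D"
    by (simp add: M_def refine)
  then have "bdiff (ramp \<eta>) (int m - 2) / real m \<le> D"
    using m by (simp add: bdiff_def field_simps)
  also have "D = ramp \<eta>' (M + 1) - ramp \<eta> (int m - 2)"
    by (simp add: D_def bdiff_def M_def refine)
  also have "ramp \<eta>' (M + 1) = F (\<eta> / real m * (real m - 1)\<^sup>2)"
  proof -
    have "M + 1 = (int m - 1)\<^sup>2" by (simp add: M_def power2_eq_square algebra_simps)
    then show ?thesis by (simp add: ramp_def \<eta>'_def)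
  qed
  also have "\<dots> \<le> ramp \<eta> (int m + 1) - 3 * ramp \<eta> (int m) + 3 * ramp \<eta> (int m - 1)"
    by (rule third_difference_test[OF \<eta> ratio]) (use m in simp)
  finally show ?thesis by (simp add: bdiff_def algebra_simps)
qed

text \<open>Summing the third-order inequality over the blocks from N to 2 N, 2 N to 4 N and 4 N to
  8 N shows that the ramp gains a factor 4 N between N - 2 and 8 N. For N a power of 2 this is a
  bounded number of doublings, each of which gains a bounded factor.\<close>

lemma not_bdiff2_ramp_ratio:
  assumes \<eta>: "0 < \<eta>"
  shows "\<not> ratio_to_1 (\<lambda>n. bdiff (bdiff (ramp \<eta>)) (int n))"
proof
  assume ratio: "ratio_to_1 (\<lambda>n. bdiff (bdiff (ramp \<eta>)) (int n))"
  define b where "b = ramp \<eta>"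
  define u where "u = bdiff b"
  define w where "w = bdiff u"
  have u_Suc: "u (z + 1) = b (z + 1) - b z" for z by (simp add: u_def bdiff_def)
  have w_Suc: "w (z + 1) = u (z + 1) - u z" for z by (simp add: w_def bdiff_def)
  have nn: "0 \<le> u z" "0 \<le> w z" "0 \<le> b z" for z
    unfolding b_def u_def w_def
    using bdiff_ramp_nonneg[OF \<eta>] bdiff2_ramp_nonneg[OF \<eta>] ramp_nonneg[OF \<eta>] by auto
  have u_mono: "y \<le> z \<Longrightarrow> u y \<le> u z" for y z unfolding b_def u_def by (rule bdiff_ramp_mono[OF \<eta>])
  have inc: "u (z - 2) / z \<le> w (z + 1) - w z" if "3 \<le> z" for z
    using bdiff2_ramp_increment[OF \<eta> ratio, of "nat z"] that by (simp add: b_def u_def w_def)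
  have w_mono: "w y \<le> w z" if "3 \<le> y" "y \<le> z" for y z
    using that(2)
  proof (induction z rule: int_ge_induct)
    case (step z)
    have "0 \<le> u (z - 2) / z" using nn(1)[of "z - 2"] that step.hyps by (intro divide_nonneg_pos) auto
    then show ?case using inc[of z] step that by simp
  qed simp
  have growth: "4 * real N * b (int N - 2) \<le> b (8 * int N)" if N: "3 \<le> N" for N
  proof -
    define d where "d = u (int N - 2)"
    have "real N * (d / (2 * real N)) \<le> w (int N + int N) - w (int N)"
    proof (rule increments_ge)
      fix z assume z: "int N \<le> z" "z < int N + int N"
      have "d / (2 * real N) \<le> u (z - 2) / z"
        unfolding d_def using z N nn(1) by (intro frac_le u_mono) auto
      also have "\<dots> \<le> w (z + 1) - w z" using z N by (intro inc) simp
      finally show "d / (2 * real N) \<le> w (z + 1) - w z" .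
    qed
    then have w: "d / 2 \<le> w (2 * int N)" using N nn(2)[of "int N"] by simp
    have "real (2 * N) * (d / 2) \<le> u (2 * int N + int (2 * N)) - u (2 * int N)"
    proof (rule increments_ge)
      fix z assume z: "2 * int N \<le> z"
      have "d / 2 \<le> w (2 * int N)" by (rule w)
      also have "\<dots> \<le> w (z + 1)" using z N by (intro w_mono) auto
      finally show "d / 2 \<le> u (z + 1) - u z" by (simp add: w_Suc)
    qed
    then have u: "real N * d \<le> u (4 * int N)" using nn(1)[of "2 * int N"] by simp
    have "real (4 * N) * (real N * d) \<le> b (4 * int N + int (4 * N)) - b (4 * int N)"
    proof (rule increments_ge)
      fix z assume z: "4 * int N \<le> z"
      have "u (4 * int N) \<le> u (z + 1)" using z by (intro u_mono) simp
      with u show "real N * d \<le> b (z + 1) - b z" by (simp add: u_Suc)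
    qed
    then have b8: "4 * real N * (real N * d) \<le> b (8 * int N)" using nn(3)[of "4 * int N"] by simp
    \<comment> \<open>Conversely, the increments up to N - 2 are at most \<open>d\<close> because
      \<open>u\<close> increases.\<close>
    have "real (N - 2) * - d \<le> - b (0 + int (N - 2)) - - b 0"
    proof (rule increments_ge[where g = "\<lambda>z. - b z"])
      fix z assume "0 \<le> z" "z < 0 + int (N - 2)"
      then have "u (z + 1) \<le> d" unfolding d_def by (intro u_mono) auto
      then show "- d \<le> - b (z + 1) - - b z" by (simp add: u_Suc)
    qed
    then have "b (int N - 2) \<le> real (N - 2) * d" using N by (simp add: b_def of_nat_diff)
    also have "\<dots> \<le> real N * d" using nn(1) by (intro mult_right_mono) (auto simp: d_def)
    finally have "4 * real N * b (int N - 2) \<le> 4 * real N * (real N * d)"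
      by (intro mult_left_mono) auto
    with b8 show ?thesis by simp
  qed
  obtain K k0 where K: "0 < K" "\<And>k. k0 \<le> k \<Longrightarrow> 0 < b (2 ^ k)"
    "\<And>k. k0 \<le> k \<Longrightarrow> b (2 ^ Suc k) \<le> K * b (2 ^ k)"
    unfolding b_def using ramp_doubling_bound[OF \<eta>] by metis
  obtain k1 where k1: "K ^ 4 < 2 ^ k1" using real_arch_pow[of 2 "K ^ 4"] by auto
  \<comment> \<open>For N = 2 ^ Suc k, the condition k \<ge> 1 gives 2 ^ k \<le> N - 2, while 8 N =
    2 ^ (k + 4) is four doublings away from 2 ^ k.\<close>
  define k where "k = max 1 (max k0 k1)"
  have k: "1 \<le> k" "k0 \<le> k" "k1 \<le> k" by (auto simp: k_def)
  have iter: "b (2 ^ (k + i)) \<le> K ^ i * b (2 ^ k)" for i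
  proof (induction i)
    case (Suc i)
    have "b (2 ^ (k + Suc i)) \<le> K * b (2 ^ (k + i))" using K(3)[of "k + i"] k by simp
    also have "\<dots> \<le> K * (K ^ i * b (2 ^ k))" using Suc K(1) by (intro mult_left_mono) auto
    finally show ?case by simp
  qed simp
  have two: "2 \<le> (2::int) ^ k" "2 \<le> (2::nat) ^ k" using power_increasing[OF k(1), of "2::int"] power_increasing[OF k(1), of "2::nat"] by auto
  have "2 ^ k * b (2 ^ k) \<le> 4 * real (2 ^ Suc k) * b (2 ^ k)"
    using nn(3) by (intro mult_right_mono) auto
  also have "\<dots> \<le> 4 * real (2 ^ Suc k) * b (int (2 ^ Suc k) - 2)"
    unfolding b_def using two(1) by (intro mult_left_mono ramp_mono[OF \<eta>]) auto
  also have "\<dots> \<le> b (8 * int (2 ^ Suc k))" using two(2) by (intro growth) simp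
  also have "8 * int (2 ^ Suc k) = 2 ^ (k + 4)" by (simp add: power_add)
  also have "b (2 ^ (k + 4)) \<le> K ^ 4 * b (2 ^ k)" by (rule iter)
  finally have "2 ^ k \<le> K ^ 4" using K(2)[OF k(2)] by simp
  moreover have "(2::real) ^ k1 \<le> 2 ^ k" using k by (intro power_increasing) auto
  ultimately show False using k1 by simp
qed

text \<open>The third difference of the triangular numbers \<open>1, 3, 6\<close> leaves only the constant term:
  \<open>F 6 - 3 F 3 + 3 F 1\<close> becomes \<open>B\<close> asymptotically.\<close>

lemma triangular_test:
  assumes \<eta>: "0 < \<eta>" and A: "0 < A" and e: "(\<lambda>n. ramp \<eta> (int n) - A * real n) \<longlonglongrightarrow> B"
  shows "0 \<le> B"
proof -
  define e where "e = (\<lambda>n. ramp \<eta> (int n) - A * real n)"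
  have ramp_eq: "ramp \<eta> (int n) = A * real n + e n" for n by (simp add: e_def)
  have nonneg_j: "0 \<le> e (6 * j) - 3 * e (3 * j) + 3 * e j" if j: "0 < j" for j
  proof -
    \<comment> \<open>The factor \<open>j\<close> turns the values of \<open>c\<close> into ramp
      values at multiples of \<open>j\<close>; for large \<open>j\<close> all errors are then close
      to \<open>B\<close>.\<close>
    define c where "c = (\<lambda>z. F (\<eta> * real j * (if - 1 \<le> z then real_of_int ((z + 1) * (z + 2)) / 2 else 0)))"
    have c: "row_consecutive_tn c"
      unfolding c_def using \<eta> j by (intro pfs_imp_row_consecutive_tn pres tp_limit_triangular) auto
    define T where "T = (\<lambda>n::nat. (n + 1) * (n + 2) div 2)"
    have T: "real (T n) = (real n + 1) * (real n + 2) / 2" for n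
    proof -
      have "even ((n + 1) * (n + 2))" by auto
      then show ?thesis unfolding T_def by (subst real_of_nat_div) (auto simp: algebra_simps)
    qed
    define E where "E = (\<lambda>n. e (j * T n))"
    have "strict_mono (\<lambda>n. j * T n)"
    proof (rule strict_mono_Suc_iff[THEN iffD2], rule allI)
      fix n
      have "real (T n) < real (T (Suc n))" by (simp add: T algebra_simps)
      then show "j * T n < j * T (Suc n)" using j by simp
    qed
    then have E: "E \<longlonglongrightarrow> B"
      using LIMSEQ_subseq_LIMSEQ[OF e, of "\<lambda>n. j * T n"] by (simp add: E_def e_def comp_def)
    \<comment> \<open>The image splits into the quadratic main term \<open>p\<close> and the
      convergent error \<open>E\<close>. Each difference lowers the degree of the main term, and the
      differences of the error still converge.\<close>
    define p where "p = (\<lambda>n. A * real j * ((real n + 1) * (real n + 2) / 2))"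
    have Aj: "0 < A * real j" using A j by simp
    have c_eq: "c (int n) = p n + E n" for n
    proof -
      have "c (int n) = F (\<eta> * real (j * T n))" by (simp add: c_def T mult_ac add.commute)
      then show ?thesis
        unfolding ramp_of_nat[symmetric] ramp_eq by (simp add: p_def E_def T)
    qed
    have "ratio_to_1 (\<lambda>n. c (int n))"
      unfolding c_eq
    proof (rule ratio_to_1_perturbation[OF _ _ E])
      show "filterlim p at_top sequentially"
        unfolding p_def by (intro filterlim_tendsto_pos_mult_at_top[OF tendsto_const Aj]) real_asymp
      have "p (Suc n) / p n = ((real (Suc n) + 1) * (real (Suc n) + 2) / 2) / ((real n + 1) * (real n + 2) / 2)" for n
        unfolding p_def using A j by (subst mult_divide_mult_cancel_left) auto
      moreover have "(\<lambda>n. ((real (Suc n) + 1) * (real (Suc n) + 2) / 2) / ((real n + 1) * (real n + 2) / 2)) \<longlonglongrightarrow> 1"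
        by real_asymp
      ultimately show "ratio_to_1 p" by simp
    qed
    note d1 = row_consecutive_tn_bdiff[OF c this]
    have c1: "bdiff c (int (Suc n)) = A * real j * (real n + 2) + (E (Suc n) - E n)" for n
      using c_eq[of "Suc n"] c_eq[of n] by (simp add: bdiff_def p_def field_simps)
    have "ratio_to_1 (\<lambda>n. bdiff c (int (Suc n)))"
      unfolding c1
    proof (rule ratio_to_1_perturbation[OF _ _ tendsto_diff[OF LIMSEQ_Suc[OF E] E]])
      show "filterlim (\<lambda>n. A * real j * (real n + 2)) at_top sequentially"
        by (intro filterlim_tendsto_pos_mult_at_top[OF tendsto_const Aj]) real_asymp
      have "(\<lambda>n. (real (Suc n) + 2) / (real n + 2)) \<longlonglongrightarrow> 1" by real_asymp
      then show "ratio_to_1 (\<lambda>n. A * real j * (real n + 2))" using A j by simp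
    qed
    then have "ratio_to_1 (\<lambda>n. bdiff c (int n))" by (rule LIMSEQ_imp_Suc)
    note d2 = row_consecutive_tn_bdiff[OF d1 this]
    have c2: "bdiff (bdiff c) (int (Suc (Suc n))) = A * real j + (E (Suc (Suc n)) - E (Suc n) - (E (Suc n) - E n))" for n
      using c1[of "Suc n"] c1[of n] by (simp add: bdiff_def[of "bdiff _"] algebra_simps)
    have "(\<lambda>n. A * real j + (E (Suc (Suc n)) - E (Suc n) - (E (Suc n) - E n))) \<longlonglongrightarrow> A * real j + (B - B - (B - B))"
      by (intro tendsto_intros LIMSEQ_Suc E)
    \<comment> \<open>The second differences tend to a positive constant, so their ratio tends to 1
      and a third difference may be taken.\<close>
    then have lim: "(\<lambda>n. bdiff (bdiff c) (int (Suc (Suc n)))) \<longlonglongrightarrow> A * real j" unfolding c2 by simp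
    have "ratio_to_1 (\<lambda>n. bdiff (bdiff c) (int (Suc (Suc n))))"
      using tendsto_divide[OF LIMSEQ_Suc[OF lim] lim] A j by simp
    then have "ratio_to_1 (\<lambda>n. bdiff (bdiff c) (int (Suc n)))" by (rule LIMSEQ_imp_Suc)
    then have "ratio_to_1 (\<lambda>n. bdiff (bdiff c) (int n))" by (rule LIMSEQ_imp_Suc)
    note d3 = row_consecutive_tn_bdiff[OF d2 this]
    have "0 \<le> bdiff (bdiff (bdiff c)) 2" by (rule row_consecutive_tn_nonneg[OF d3])
    also have "\<dots> = c (int 2) - 3 * c (int 1) + 3 * c (int 0)"
      by (simp add: bdiff_def) (simp add: c_def F_0)
    \<comment> \<open>The main terms cancel: 6 - 3 * 3 + 3 * 1 = 0.\<close>
    also have "\<dots> = E 2 - 3 * E 1 + 3 * E 0"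
      unfolding c_eq by (simp add: p_def)
    also have "\<dots> = e (6 * j) - 3 * e (3 * j) + 3 * e j"
    proof -
      have "T 0 = 1" "T 1 = 3" "T 2 = 6" by (simp_all add: T_def)
      then show ?thesis by (simp add: E_def mult.commute)
    qed
    finally show ?thesis .
  qed
  have "(\<lambda>j. e (6 * j) - 3 * e (3 * j) + 3 * e j) \<longlonglongrightarrow> B - 3 * B + 3 * B"
    unfolding e_def
    by (intro tendsto_intros e LIMSEQ_subseq_LIMSEQ[OF e, of "\<lambda>j. 6 * j", unfolded comp_def]
        LIMSEQ_subseq_LIMSEQ[OF e, of "\<lambda>j. 3 * j", unfolded comp_def]) (auto simp: strict_mono_def)
  then have "0 \<le> B - 3 * B + 3 * B"
    by (rule LIMSEQ_le_const) (use nonneg_j in \<open>auto intro!: exI[of _ 1]\<close>)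
  then show ?thesis by simp
qed

end

section \<open>Linearity of \<open>F\<close>\<close>

context nontrivial_preserver begin

text \<open>The differences \<open>u\<close> increase to a slope \<open>A\<close> exponentially
  fast, so the sum \<open>S\<close> of all \<open>A - u n\<close> is finite and the ramp is A n + (A
  - S) + o(1). The first summand of \<open>S\<close> is already \<open>A\<close>, which gives the
  upper bound A n; the triangular test gives S \<le> A and with it the lower bound.\<close>

lemma ramp_linear:
  assumes \<eta>: "0 < \<eta>"
  shows "F (\<eta> * real n) = real n * F \<eta>"
proof -
  define u where "u = (\<lambda>n. bdiff (ramp \<eta>) (int n))"
  define w where "w = (\<lambda>n. bdiff (bdiff (ramp \<eta>)) (int n))"
  have u_nn: "0 \<le> u n" and w_nn: "0 \<le> w n" for n
    using bdiff_ramp_nonneg[OF \<eta>] bdiff2_ramp_nonneg[OF \<eta>] by (auto simp: u_def w_def)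
  have w_Suc: "w (Suc n) = u (Suc n) - u n" for n by (simp add: w_def u_def bdiff_def[of "bdiff _"])
  have u_0: "u 0 = 0" by (simp add: u_def bdiff_def)
  have u_mono: "incseq u"
  proof (rule incseq_SucI)
    show "u n \<le> u (Suc n)" for n using w_nn[of "Suc n"] by (simp add: w_Suc)
  qed
  have sum_u: "(\<Sum>k\<le>n. u k) = ramp \<eta> (int n)" for n unfolding u_def by (rule sum_bdiff_ramp[OF \<eta>])
  have "w n \<le> u n" for n
    using bdiff_ramp_nonneg[OF \<eta>, of "int n - 1"] by (simp add: w_def u_def bdiff_def[of "bdiff _"])
  then have "ratio_to_1 w \<or> (\<exists>C q M. 0 < q \<and> q < 1 \<and> (\<forall>n\<ge>M. w n \<le> C * q ^ n))"
    using log_concave_row_consecutive_tn[OF ramp_bdiff2_row_consecutive_tn[OF \<eta>]] bdiff_ramp_ratio[OF \<eta>]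
    by (intro log_concave_dichotomy[of w u]) (auto simp: w_def u_def)
  then obtain C q M where q: "0 < q" "q < 1" and w_le: "\<And>n. M \<le> n \<Longrightarrow> w n \<le> C * q ^ n"
    using not_bdiff2_ramp_ratio[OF \<eta>] unfolding w_def by blast
  have C: "0 \<le> C"
    using order_trans[OF w_nn w_le[of M]] zero_less_power[OF q(1), of M] by (simp add: zero_le_mult_iff)
  \<comment> \<open>Chosen so that \<open>D * (1 - q) = C * q\<close>; then
    \<open>u n + D * q ^ n\<close> is nonincreasing from \<open>M\<close> on.\<close>
  define D where "D = C * q / (1 - q)"
  have D: "0 \<le> D" using C q by (simp add: D_def)
  define v where "v = (\<lambda>n. u n + D * q ^ n)"
  have v_Suc: "v (Suc n) \<le> v n" if "M \<le> n" for n
  proof -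
    have "D * q ^ n - D * q ^ Suc n = (D * (1 - q)) * q ^ n" by (simp add: algebra_simps)
    also have "D * (1 - q) = C * q" using q by (simp add: D_def)
    finally show ?thesis using w_le[of "Suc n"] that by (simp add: v_def w_Suc algebra_simps)
  qed
  have v_anti: "v n \<le> v m" if "M \<le> m" "m \<le> n" for m n
    using that(2)
  proof (induction n rule: dec_induct)
    case (step n)
    then show ?case using v_Suc[of n] that(1) by simp
  qed simp
  have u_le_v: "u n \<le> v n" for n using D q by (simp add: v_def)
  have "u n \<le> v M" for n
  proof -
    have "u n \<le> u (max n M)" using u_mono by (rule incseqD) simp
    also have "\<dots> \<le> v (max n M)" by (rule u_le_v)
    also have "\<dots> \<le> v M" by (rule v_anti) auto
    finally show ?thesis .
  qed
  then obtain A where A: "u \<longlonglongrightarrow> A" "\<And>n. u n \<le> A"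
    using incseq_convergent[OF u_mono] by metis
  have "(\<lambda>n. u n + D * q ^ n) \<longlonglongrightarrow> A + D * 0"
    using q by (intro tendsto_intros A(1) LIMSEQ_realpow_zero) auto
  then have v_lim: "v \<longlonglongrightarrow> A" by (simp add: v_def[abs_def])
  have A_le: "A - u n \<le> D * q ^ n" if "M \<le> n" for n
  proof -
    have "A \<le> v n" by (rule LIMSEQ_le_const2[OF v_lim]) (use v_anti[OF that] in blast)
    then show ?thesis by (simp add: v_def)
  qed
  have summable: "summable (\<lambda>n. A - u n)"
    by (rule summable_if_le_geometric[of _ q M D]) (use A q A_le in auto)
  define S where "S = (\<Sum>n. A - u n)"
  have partial: "(\<Sum>k\<le>n. A - u k) = A * real (Suc n) - ramp \<eta> (int n)" for n
    by (simp add: sum_subtractf sum_u mult.commute)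
  have S_lim: "(\<lambda>n. A * real (Suc n) - ramp \<eta> (int n)) \<longlonglongrightarrow> S"
    unfolding partial[symmetric] S_def by (rule summable_LIMSEQ'[OF summable])
  have "(\<lambda>n. A - (A * real (Suc n) - ramp \<eta> (int n))) \<longlonglongrightarrow> A - S"
    by (intro tendsto_intros S_lim)
  then have e_lim: "(\<lambda>n. ramp \<eta> (int n) - A * real n) \<longlonglongrightarrow> A - S"
    by (simp add: algebra_simps)
  have upper: "ramp \<eta> (int n) \<le> A * real n" for n
  proof -
    have "A - u 0 \<le> (\<Sum>k\<le>n. A - u k)" by (rule member_le_sum) (use A in auto)
    then show ?thesis by (simp add: partial u_0 algebra_simps)
  qed
  have A_pos: "0 < A"
  proof -
    obtain N where N: "0 < N" "0 < ramp \<eta> (int N)" using ramp_pos[OF \<eta>] by (metis order_refl)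
    then have "0 < A * real N" using upper[of N] by linarith
    then show ?thesis using N(1) by (simp add: zero_less_mult_iff)
  qed
  have S_le: "0 \<le> A - S" by (rule triangular_test[OF \<eta> A_pos e_lim])
  have "A * real n \<le> ramp \<eta> (int n)" for n
  proof -
    have "(\<Sum>k\<le>n. A - u k) \<le> S"
      unfolding S_def using summable A(2) by (intro sum_le_suminf) auto
    then show ?thesis using S_le partial[of n] by (simp add: algebra_simps)
  qed
  then have "ramp \<eta> (int n) = A * real n" for n using upper[of n] by (simp add: antisym)
  from this[of n] this[of 1] show ?thesis unfolding ramp_of_nat by simp
qed

lemma F_pos:
  assumes "0 < x"
  shows "0 < F x"
proof -
  obtain N where "0 < ramp x (int N)" using ramp_pos[OF assms] by (metis order_refl)
  then have "0 < real N * F x" by (simp add: ramp_of_nat ramp_linear[OF assms])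
  then show ?thesis by (simp add: zero_less_mult_iff)
qed

lemma F_rational:
  assumes "0 < p" "0 < q"
  shows "F (real p / real q) = real p / real q * F 1"
proof -
  have "F (1 / real q * real q) = real q * F (1 / real q)" "F (1 / real q * real p) = real p * F (1 / real q)"
    using assms by (intro ramp_linear; simp)+
  then show ?thesis using assms by (simp add: field_simps)
qed

text \<open>Monotonicity is available across a factor of at least 2, so \<open>y\<close> is compared
  with a rational number between y / 4 and y / 2.\<close>

lemma F_lower_bound:
  assumes y: "0 < y"
  shows "F 1 / 4 * y \<le> F y"
proof -
  obtain r where r: "r \<in> \<rat>" "y / 4 < r" "r < y / 2" using Rats_dense_in_real[of "y / 4" "y / 2"] y by auto
  then have "0 < r" using y by simp
  then obtain p q :: nat where pq: "q \<noteq> 0" "r = real p / real q"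
    using Rats_abs_nat_div_natE[OF r(1)] by (metis abs_of_pos)
  then have "0 < p" using \<open>0 < r\<close> by (cases "p = 0") auto
  then have "F r = r * F 1" using F_rational[of p q] pq by simp
  moreover have "y / 4 * F 1 \<le> r * F 1" using r F_pos[of 1] by (intro mult_right_mono) auto
  moreover have "F r \<le> F y" by (rule three_terms(1)) (use \<open>0 < r\<close> r in auto)
  ultimately show ?thesis by (simp add: mult.commute)
qed

text \<open>Otherwise log-concavity along the sequence y x^n would keep all ratios at most some
  \<rho> < x, and \<open>F\<close> would fall below its linear lower bound.\<close>

lemma F_scaling_ge:
  assumes "0 < y" "0 < x"
  shows "x * F y \<le> F (y * x)"
proof (rule ccontr)
  assume "\<not> x * F y \<le> F (y * x)"
  then have less: "F (y * x) < x * F y" by simp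
  define g where "g = (\<lambda>n. F (y * x ^ n))"
  have lc: "log_concave g" unfolding g_def by (rule geometric_log_concave[OF assms])
  have pos: "0 < g n" for n unfolding g_def using assms by (intro F_pos) simp
  define \<rho> where "\<rho> = g 1 / g 0"
  have \<rho>: "0 < \<rho>" "\<rho> < x" using pos[of 0] pos[of 1] less by (auto simp: \<rho>_def g_def divide_less_eq)
  have upper: "g n \<le> \<rho> ^ n * g 0" for n
  proof (induction n)
    case (Suc n)
    have "g (Suc n) / g n \<le> \<rho>"
      unfolding \<rho>_def using log_concave_ratio_antimono[OF lc, of 0 0 n] pos by simp
    then have "g (Suc n) \<le> \<rho> * g n" using pos[of n] by (simp add: divide_le_eq)
    also have "\<dots> \<le> \<rho> * (\<rho> ^ n * g 0)" using Suc \<rho> by (intro mult_left_mono) auto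
    finally show ?case by simp
  qed simp
  define c where "c = F 1 / 4 * y"
  have c: "0 < c" using F_pos[of 1] assms by (simp add: c_def)
  have "1 < x / \<rho>" using \<rho> by simp
  then obtain n where n: "g 0 / c < (x / \<rho>) ^ n" using real_arch_pow by blast
  have "c * x ^ n \<le> g n"
    using F_lower_bound[of "y * x ^ n"] assms by (simp add: c_def g_def mult.assoc)
  with upper[of n] have "c * x ^ n \<le> \<rho> ^ n * g 0" by simp
  moreover have "\<rho> ^ n * g 0 < c * x ^ n" using n c \<rho> by (simp add: power_divide field_simps)
  ultimately show False by simp
qed

text \<open>Both inequalities are the scaling bound, taken from 1 to \<open>x\<close> and from
  \<open>x\<close> back to 1.\<close>

lemma F_linear:
  assumes "0 < x"
  shows "F x = F 1 * x"
proof (rule antisym)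
  show "F 1 * x \<le> F x" using F_scaling_ge[of 1 x] assms by (simp add: mult.commute)
  show "F x \<le> F 1 * x" using F_scaling_ge[of x "1 / x"] assms by (simp add: field_simps)
qed

end

theorem preserver_classification:
  assumes nn: "\<And>x. 0 \<le> x \<Longrightarrow> 0 \<le> F x"
    and pres: "\<And>a. tp_limit a \<Longrightarrow> polya_frequency_sequence (\<lambda>n. F (a n))"
  shows "\<exists>c\<ge>0. (\<forall>x\<ge>0. F x = c) \<or> (\<forall>x\<ge>0. F x = c * x)"
proof (cases "F 0 = 0")
  case False
  then have "0 < F 0" using nn[of 0] by simp
  then have "\<forall>x\<ge>0. F x = F 0" using preserver_const[of F, OF nn pres] by blast
  then show ?thesis using \<open>0 < F 0\<close> less_imp_le by blast
next
  case F0: True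
  show ?thesis
  proof (cases "\<exists>x>0. 0 < F x")
    case True
    then obtain x0 where "0 < x0" "0 < F x0" by blast
    then interpret nontrivial_preserver F x0
      using nn pres F0 by unfold_locales auto
    have "\<forall>x\<ge>0. F x = F 1 * x" using F_linear F0 by (metis mult_zero_right order.order_iff_strict)
    moreover have "0 \<le> F 1" by (rule nn) simp
    ultimately show ?thesis by blast
  next
    case False
    then have "\<forall>x\<ge>0. F x = 0" using nn F0 by (metis order.order_iff_strict)
    then show ?thesis by (intro exI[of _ 0]) auto
  qed
qed

section \<open>Preservers of total positivity\<close>

lemma tp_imp_pfs: "tp_polya_frequency_sequence a \<Longrightarrow> polya_frequency_sequence a"
  by (simp add: tp_polya_frequency_sequence_def)

lemma tp_pfs_pos:
  assumes "tp_polya_frequency_sequence a"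
  shows "0 < a n"
proof -
  have "0 < toeplitz_minor a (Suc 0) (\<lambda>_. n) (\<lambda>_. 0)" using assms incr_1 by (simp add: tp_pfs_iff)
  then show ?thesis by (simp add: toeplitz_minor_def fun_det_1)
qed

lemma tp_limit_imp_pfs: "tp_limit a \<Longrightarrow> polya_frequency_sequence a"
  unfolding tp_limit_def using pfs_limit tp_imp_pfs by blast

lemma pfs_const:
  assumes "0 \<le> c"
  shows "polya_frequency_sequence (\<lambda>_. c)"
  unfolding pfs_iff
proof (intro allI impI)
  fix n i j
  consider "n = 0" | "n = Suc 0" | "2 \<le> n" by linarith
  then show "0 \<le> toeplitz_minor (\<lambda>_. c) n i j"
  proof cases
    case 3
    then have "toeplitz_minor (\<lambda>_. c) n i j = 0" unfolding toeplitz_minor_def by (intro fun_det_eq_rows[of 0 _ 1]) auto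
    then show ?thesis by simp
  qed (use assms in \<open>auto simp: toeplitz_minor_def fun_det_1\<close>)
qed

text \<open>Any such y, x, z are consecutive terms of a Gaussian sequence, and the claim is a 2 by 2
  minor of its image.\<close>

lemma tp_preserver_log_concave:
  assumes pres: "\<And>a. tp_polya_frequency_sequence a \<Longrightarrow> tp_polya_frequency_sequence (F \<circ> a)"
    and "0 < x" "0 < y" "0 < z" "y * z < x\<^sup>2"
  shows "F y * F z < (F x)\<^sup>2"
proof -
  \<comment> \<open>Obtained by solving x q / r = y and x q r = z; the assumption on y z says that q
    < 1.\<close>
  define q where "q = sqrt (y * z) / x"
  define r where "r = z / (x * q)"
  have sq: "(sqrt (y * z))\<^sup>2 = y * z" "0 < sqrt (y * z)" using assms by auto
  have q0: "0 < q" using assms by (simp add: q_def)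
  have "sqrt (y * z) < x" using assms by (simp add: real_less_lsqrt)
  then have q1: "q < 1" using assms by (simp add: q_def)
  have r: "0 < r" using assms q0 by (simp add: r_def)
  have "x * q * (x * q) = y * z" using sq assms by (simp add: q_def power2_eq_square)
  then have vals: "x * r * q = z" "x / r * q = y" using assms q0 by (auto simp: r_def field_simps)
  define a where "a = (\<lambda>n::int. x * r powi n * q powi (n * n))"
  have a: "a 0 = x" "a 1 = z" "a (- 1) = y" using vals by (auto simp: a_def power_int_minus divide_inverse)
  have "tp_polya_frequency_sequence (F \<circ> a)"
    unfolding a_def using q0 q1 r assms by (intro pres tp_pfs_gaussian)
  moreover have "incr 2 int" by (auto simp: strict_mono_on_def)
  ultimately have "0 < toeplitz_minor (F \<circ> a) 2 int int" by (simp add: tp_pfs_iff)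
  then show ?thesis by (simp add: toeplitz_minor_def fun_det_2 a power2_eq_square)
qed

locale tp_preserver =
  fixes F :: "real \<Rightarrow> real"
  assumes pos: "\<And>x. 0 < x \<Longrightarrow> 0 < F x"
    and pres: "\<And>a. tp_polya_frequency_sequence a \<Longrightarrow> tp_polya_frequency_sequence (F \<circ> a)"
begin

lemma strict_mono_pos:
  assumes "0 < y" "y < x"
  shows "F y < F x"
proof -
  have "y * y < x\<^sup>2" using assms by (simp add: power2_eq_square mult_strict_mono)
  then have "F y * F y < (F x)\<^sup>2" using assms by (intro tp_preserver_log_concave[OF pres]) auto
  then show ?thesis using pos[of x] assms by (intro power2_less_imp_less[of "F y"]) (auto simp: power2_eq_square)
qed

text \<open>A jump at \<open>x\<close> by a factor \<open>c\<close> would force the left limit of \<open>F\<close> at \<open>x\<close> to exceed itself by that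
  factor.\<close>

lemma no_jump:
  assumes "0 < x" "1 < c"
  shows "\<exists>s>1. F (x * s) < c * F (x / s)"
proof (rule ccontr)
  assume "\<not> ?thesis"
  then have jump: "c * F (x / s) \<le> F (x * s)" if "1 < s" for s using that by (metis not_less)
  \<comment> \<open>The Gaussian inequality applies to x / s^4, x / s, x s because s^(-4) s <
    s^(-2). It carries the jump over to the points x / s^4 and x / s, both to the left of
    \<open>x\<close>.\<close>
  have step: "c * F (x / s ^ 4) < F (x / s)" if s: "1 < s" for s
  proof -
    have "x / s ^ 4 * (x * s) < (x / s)\<^sup>2"
      using s assms(1) by (simp add: power2_eq_square eval_nat_numeral field_simps)
    then have "F (x / s ^ 4) * F (x * s) < (F (x / s))\<^sup>2"
      using s assms(1) by (intro tp_preserver_log_concave[OF pres]) auto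
    moreover have "F (x / s ^ 4) * (c * F (x / s)) \<le> F (x / s ^ 4) * F (x * s)"
      using jump[OF s] pos[of "x / s ^ 4"] s assms(1) by (intro mult_left_mono) auto
    ultimately have "(c * F (x / s ^ 4)) * F (x / s) < F (x / s) * F (x / s)"
      by (simp add: power2_eq_square mult_ac)
    then show ?thesis using pos[of "x / s"] s assms(1) by simp
  qed
  \<comment> \<open>By monotonicity \<open>l\<close> is the left limit of \<open>F\<close> at
    \<open>x\<close>.\<close>
  define l where "l = (SUP y\<in>{0<..<x}. F y)"
  have bdd: "bdd_above (F ` {0<..<x})"
    using strict_mono_pos by (intro bdd_aboveI[of _ "F x"]) (auto simp: less_imp_le)
  have upper: "F y \<le> l" if "0 < y" "y < x" for y
    unfolding l_def using that by (intro cSUP_upper[OF _ bdd]) auto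
  have "c * F y \<le> l" if y: "0 < y" "y < x" for y
  proof -
    define s where "s = root 4 (x / y)"
    have s: "s ^ 4 = x / y" "1 < s" using y by (auto simp: s_def)
    have "x / s ^ 4 = y" using y unfolding s(1) by simp
    then have "c * F y < F (x / s)" using step[OF s(2)] by simp
    also have "\<dots> \<le> l" using s(2) assms(1) by (intro upper) (auto simp: divide_less_eq)
    finally show ?thesis by simp
  qed
  then have "F y \<le> l / c" if "0 < y" "y < x" for y
    using that assms(2) by (simp add: field_simps)
  then have "l \<le> l / c"
    unfolding l_def using assms(1) by (intro cSUP_least) auto
  moreover have "0 < l"
    using pos[of "x / 2"] upper[of "x / 2"] assms(1) by simp
  ultimately show False using assms(2) by (simp add: field_simps)
qed

lemma tendsto_at_pos:
  assumes X: "X \<longlonglongrightarrow> (x::real)" "0 < x"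
  shows "(\<lambda>m. F (X m)) \<longlonglongrightarrow> F x"
proof -
  have near: "\<forall>\<^sub>F m in sequentially. F x / c < F (X m) \<and> F (X m) < c * F x" if c: "1 < c" for c
  proof -
    \<comment> \<open>Between x / s and x s, an interval that eventually contains
      \<open>X m\<close>, the values of \<open>F\<close> differ by less than the factor
      \<open>c\<close>.\<close>
    obtain s where s: "1 < s" "F (x * s) < c * F (x / s)" using no_jump[OF X(2) c] by blast
    have "x / s < x" "x < x * s" "0 < x / s" using s(1) X(2) by (auto simp: divide_less_eq)
    note xs = this
    have "\<forall>\<^sub>F m in sequentially. x / s < X m" "\<forall>\<^sub>F m in sequentially. X m < x * s"
      using order_tendstoD[OF X(1)] xs by auto
    then show ?thesis
    proof eventually_elim
      case (elim m)
      have "F (x / s) < F (X m)" "F (X m) < F (x * s)" "F (x / s) < F x" "F x < F (x * s)"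
        using strict_mono_pos elim xs by auto
      moreover have "c * F (x / s) < c * F x" "c * F (x / s) < c * F (X m)" using calculation c by auto
      ultimately have "F (X m) < c * F x" "F x < c * F (X m)" using s(2) by auto
      then show ?case using c by (simp add: divide_less_eq mult.commute)
    qed
  qed
  show ?thesis
  proof (rule order_tendstoI)
    fix a assume a: "a < F x"
    show "\<forall>\<^sub>F m in sequentially. a < F (X m)"
    proof (cases "0 < a")
      case True
      then show ?thesis using near[of "F x / a"] a pos[OF X(2)] by (auto elim: eventually_mono)
    next
      case False
      have "0 < F x / 2" using pos[OF X(2)] by simp
      with near[of 2] False show ?thesis by (auto elim!: eventually_mono)
    qed
  next
    fix b assume "F x < b"
    then show "\<forall>\<^sub>F m in sequentially. F (X m) < b"
      using near[of "b / F x"] pos[OF X(2)] by (auto elim: eventually_mono)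
  qed
qed

text \<open>By monotonicity this infimum is the right limit of \<open>F\<close> at 0.\<close>

definition F_0_plus :: real where
  "F_0_plus = (INF x\<in>{0<..}. F x)"

lemma bdd_below_image: "bdd_below (F ` {0<..})"
  using pos by (intro bdd_belowI[of _ 0]) (auto simp: less_imp_le)

lemma F_0_plus_le: "0 < x \<Longrightarrow> F_0_plus \<le> F x"
  unfolding F_0_plus_def by (rule cINF_lower[OF bdd_below_image]) simp

lemma F_0_plus_nonneg: "0 \<le> F_0_plus"
  unfolding F_0_plus_def using pos by (intro cINF_greatest) (auto simp: less_imp_le)

lemma tendsto_at_0:
  assumes X: "X \<longlonglongrightarrow> (0::real)" and X_pos: "\<And>m. 0 < X m"
  shows "(\<lambda>m. F (X m)) \<longlonglongrightarrow> F_0_plus"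
proof (rule order_tendstoI)
  fix a assume "a < F_0_plus"
  then show "\<forall>\<^sub>F m in sequentially. a < F (X m)"
    using less_le_trans[OF _ F_0_plus_le[OF X_pos]] by (simp add: always_eventually)
next
  fix b assume "F_0_plus < b"
  then obtain x where x: "0 < x" "F x < b"
  proof -
    have "(INF x\<in>{0<..}. F x) < b" using \<open>F_0_plus < b\<close> by (simp only: F_0_plus_def)
    then have "\<exists>x\<in>{0<..}. F x < b" by (subst (asm) cINF_less_iff[OF _ bdd_below_image]) auto
    then show ?thesis using that by auto
  qed
  have "\<forall>\<^sub>F m in sequentially. X m < x" using order_tendstoD(2)[OF X] x by simp
  then show "\<forall>\<^sub>F m in sequentially. F (X m) < b"
  proof eventually_elim
    case (elim m)
    from strict_mono_pos[OF X_pos elim] x(2) show ?case by simp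
  qed
qed

lemma F_linear_pos: "\<exists>c>0. \<forall>x>0. F x = c * x"
proof -
  \<comment> \<open>A limit of positive sequences may have zero entries, so \<open>F\<close> is
    extended to 0 by its right limit.\<close>
  define G where "G = (\<lambda>x. if 0 < x then F x else F_0_plus)"
  have "\<exists>c\<ge>0. (\<forall>x\<ge>0. G x = c) \<or> (\<forall>x\<ge>0. G x = c * x)"
  proof (rule preserver_classification)
    show "0 \<le> G x" for x using pos F_0_plus_nonneg by (simp add: G_def less_imp_le)
    fix a assume "tp_limit a"
    then obtain A where A: "\<And>m::nat. tp_polya_frequency_sequence (A m)" "\<And>n. (\<lambda>m. A m n) \<longlonglongrightarrow> a n"
      unfolding tp_limit_def by blast
    show "polya_frequency_sequence (\<lambda>n. G (a n))"
    proof (rule pfs_limit)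
      show "polya_frequency_sequence (\<lambda>n. F (A m n))" for m
        using pres[OF A(1)] tp_imp_pfs by (simp add: comp_def)
      fix n
      have "0 \<le> a n" by (rule LIMSEQ_le_const[OF A(2)]) (use tp_pfs_pos[OF A(1)] in \<open>auto simp: less_imp_le\<close>)
      then show "(\<lambda>m. F (A m n)) \<longlonglongrightarrow> G (a n)"
        using tendsto_at_pos[OF A(2)] tendsto_at_0[of "\<lambda>m. A m n"] A(2)[of n] tp_pfs_pos[OF A(1)]
        by (cases "a n = 0") (auto simp: G_def)
    qed
  qed
  then obtain c where c: "0 \<le> c" "(\<forall>x\<ge>0. G x = c) \<or> (\<forall>x\<ge>0. G x = c * x)" by blast
  \<comment> \<open>Strict monotonicity rules out the constant case.\<close>
  have "F 1 < F 2" by (rule strict_mono_pos) auto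
  then have "G 1 < G 2" by (simp add: G_def)
  with c(2) have lin: "\<forall>x\<ge>0. G x = c * x" by auto
  have F_eq: "F x = c * x" if "0 < x" for x using lin[rule_format, of x] that by (simp add: G_def)
  moreover have "0 < c" using pos[of 1] F_eq[of 1] by simp
  ultimately show ?thesis by blast
qed

end

theorem theorem1p6:
  shows "(\<forall>F :: real \<Rightarrow> real. F ` {0..} \<subseteq> {0..} \<longrightarrow>
            ((\<forall>a. polya_frequency_sequence a \<longrightarrow> polya_frequency_sequence (F \<circ> a)) \<longleftrightarrow>
             (\<exists>c\<ge>0. (\<forall>x\<ge>0. F x = c) \<or> (\<forall>x\<ge>0. F x = c * x)))) \<and>
         (\<forall>F :: real \<Rightarrow> real. F ` {0<..} \<subseteq> {0<..} \<longrightarrow>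
            ((\<forall>a. tp_polya_frequency_sequence a \<longrightarrow> tp_polya_frequency_sequence (F \<circ> a)) \<longleftrightarrow>
             (\<exists>c>0. \<forall>x>0. F x = c * x)))"
proof (intro conjI allI impI)
  fix F :: "real \<Rightarrow> real" assume F: "F ` {0..} \<subseteq> {0..}"
  show "(\<forall>a. polya_frequency_sequence a \<longrightarrow> polya_frequency_sequence (F \<circ> a)) \<longleftrightarrow>
     (\<exists>c\<ge>0. (\<forall>x\<ge>0. F x = c) \<or> (\<forall>x\<ge>0. F x = c * x))"
  proof
    assume "\<forall>a. polya_frequency_sequence a \<longrightarrow> polya_frequency_sequence (F \<circ> a)"
    then show "\<exists>c\<ge>0. (\<forall>x\<ge>0. F x = c) \<or> (\<forall>x\<ge>0. F x = c * x)"
      using F tp_limit_imp_pfs by (intro preserver_classification) (auto simp: comp_def)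
  next
    assume "\<exists>c\<ge>0. (\<forall>x\<ge>0. F x = c) \<or> (\<forall>x\<ge>0. F x = c * x)"
    then obtain c where c: "0 \<le> c" "(\<forall>x\<ge>0. F x = c) \<or> (\<forall>x\<ge>0. F x = c * x)" by blast
    show "\<forall>a. polya_frequency_sequence a \<longrightarrow> polya_frequency_sequence (F \<circ> a)"
    proof (intro allI impI)
      fix a assume a: "polya_frequency_sequence a"
      then have "F \<circ> a = (\<lambda>_. c) \<or> F \<circ> a = (\<lambda>n. c * a n)"
        using c(2) pfs_nonneg[OF a] by (auto simp: fun_eq_iff)
      then show "polya_frequency_sequence (F \<circ> a)"
        using pfs_const[OF c(1)] pfs_scale[OF a c(1)] by auto
    qed
  qed
next
  fix F :: "real \<Rightarrow> real" assume F: "F ` {0<..} \<subseteq> {0<..}"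
  show "(\<forall>a. tp_polya_frequency_sequence a \<longrightarrow> tp_polya_frequency_sequence (F \<circ> a)) \<longleftrightarrow>
     (\<exists>c>0. \<forall>x>0. F x = c * x)"
  proof
    assume "\<forall>a. tp_polya_frequency_sequence a \<longrightarrow> tp_polya_frequency_sequence (F \<circ> a)"
    then interpret tp_preserver F using F by unfold_locales auto
    show "\<exists>c>0. \<forall>x>0. F x = c * x" by (rule F_linear_pos)
  next
    assume "\<exists>c>0. \<forall>x>0. F x = c * x"
    then obtain c where c: "0 < c" "\<And>x. 0 < x \<Longrightarrow> F x = c * x" by blast
    show "\<forall>a. tp_polya_frequency_sequence a \<longrightarrow> tp_polya_frequency_sequence (F \<circ> a)"
    proof (intro allI impI)
      fix a assume a: "tp_polya_frequency_sequence a"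
      then have "F \<circ> a = (\<lambda>n. c * a n)" using c(2) tp_pfs_pos[OF a] by (auto simp: fun_eq_iff)
      then show "tp_polya_frequency_sequence (F \<circ> a)"
        using a c(1) by (simp add: tp_pfs_iff toeplitz_minor_scale)
    qed
  qed
qed

end
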